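(* Let $g\ge 3$ and let $\mathcal{C}$ be a non-hyperelliptic connected component of the minimal stratum $\mathcal{H}(2g-2)$. Let $\pi$ be a permutation in a Rauzy class representing $\mathcal{C}$ (so $|\mathcal{A}|=2g$ and $\Omega_\pi$ is a unimodular symplectic form on $\mathbb{Z}^{\mathcal{A}}$). Then $$\mathrm{RV}(\pi)=\{S\in\mathrm{Sp}(\Omega_\pi,\mathbb{Z}) : \overline{S}\in O(Q_\pi)\},$$ i.e. $\mathrm{RV}(\pi)$ is the preimage of $O(Q_\pi)$ under the modulus-two reduction $\mathrm{Sp}(\Omega_\pi,\mathbb{Z})\to\mathrm{Sp}(\overline{\Omega}_\pi,\mathbb{Z}/2\mathbb{Z})$.
   Context: Permutations. Let $\mathcal{A}$ be a finite alphabet with $d=|\mathcal{A}|\ge 3$. A permutation is a pair $\pi=(\pi_{\mathrm t},\pi_{\mathrm b})$ of bijections $\mathcal{A}\to\{1,\dots,d\}$; write $\alpha_{\varepsilon,j}=\pi_\varepsilon^{-1}(j)$. Permutations are assumed irreducible ($\pi_{\mathrm t}^{-1}(\{1,\dots,j\})\ne\pi_{\mathrm b}^{-1}(\{1,\dots,j\})$ for $1\le j<d$) and nondegenerate (no $1\le j<d$ satisfies any of: (i) $\pi_{\mathrm b}(\alpha_{\mathrm t,j})=d$, $\pi_{\mathrm b}(\alpha_{\mathrm t,j+1})=1$, $\pi_{\mathrm b}(\alpha_{\mathrm t,1})=\pi_{\mathrm b}(\alpha_{\mathrm t,d})+1$; (ii) $\pi_{\mathrm b}(\alpha_{\mathrm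 t,j+1})=1$, $\pi_{\mathrm b}(\alpha_{\mathrm t,1})=\pi_{\mathrm b}(\alpha_{\mathrm t,j})+1$; (iii) $\pi_{\mathrm b}(\alpha_{\mathrm t,j})=d$, $\pi_{\mathrm b}(\alpha_{\mathrm t,j+1})=\pi_{\mathrm b}(\alpha_{\mathrm t,d})+1$). Rauzy induction: the top operation, with $\alpha_{\mathrm b,k}=\alpha_{\mathrm t,d}$, replaces the bottom row by $\alpha_{\mathrm b,1},\dots,\alpha_{\mathrm b,k},\alpha_{\mathrm b,d},\alpha_{\mathrm b,k+1},\dots,\alpha_{\mathrm b,d-1}$ (winner $\alpha_{\mathrm t,d}$, loser $\alpha_{\mathrm b,d}$); the bottom operation, with $\alpha_{\mathrm t,k}=\alpha_{\mathrm b,d}$, replaces the top row by $\alpha_{\mathrm t,1},\dots,\alpha_{\mathrm t,k},\alpha_{\mathrm t,d},\alpha_{\mathrm t,k+1},\dots,\alpha_{\mathrm t,d-1}$ (winner $\alpha_{\mathrm b,d}$, loser $\alpha_{\mathrm t,d}$). Rauzy classes are connected components of the resulting directed graph; each corresponds to a connected component of a stratum of translation surfaces containing the suspensions $M_\pi$ of its permutations. $(\Omega_\pi)_{\alpha\beta}=+1$ if $\pi_{\mathrm t}(\alpha)<\pi_{\mathrm t}(\beta)$ and $\pi_{\mathrm b}(\alpha)>\pi_{\mathrm b}(\beta)$, $-1$ if the reverse inequalities hold, $0$ otherwise. For an arrow $\gamma$ with winner $\alpha_{\mathrm w}$, loser $\alpha_{\mathrm l}$, $B_\gamma=\mathrm{Id}+E_{\alpha_{\mathrm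 l}\alpha_{\mathrm w}}$, $B_{\gamma^{-1}}=B_\gamma^{-1}$, and $B_{\gamma_1\cdots\gamma_n}=B_{\gamma_n}\cdots B_{\gamma_1}$. $\mathrm{RV}(\pi)$ is the group of $B_\gamma$ over closed walks $\gamma$ (arrows and reversed arrows) at $\pi$, a subgroup of $\mathrm{Sp}(\Omega_\pi,\mathbb{Z})=\{S: S\Omega_\pi S^{\intercal}=\Omega_\pi\}$ acting on row vectors. Quadratic form: a bar denotes reduction mod $2$. For $u\in(\mathbb{Z}/2\mathbb{Z})^{\mathcal{A}}$, $Q_\pi(u)=\sum_{\pi_{\mathrm t}(\alpha)<\pi_{\mathrm t}(\beta)}u_\alpha(\Omega_\pi)_{\alpha\beta}u_\beta+\sum_{\alpha}u_\alpha \bmod 2$ (the usual quadratic form on mod-2 homology). $O(Q_\pi)$ is the group of invertible linear maps $S$ of $(\mathbb{Z}/2\mathbb{Z})^{\mathcal{A}}$ (row action) with $Q_\pi(uS)=Q_\pi(u)$ for all $u$. The non-hyperelliptic components of $\mathcal{H}(2g-2)$ are $\mathcal{H}(2g-2)^{\mathrm{odd}}$ for $g\ge3$ and $\mathcal{H}(2g-2)^{\mathrm{even}}$ for $g\ge4$ (Kontsevich–Zorich classification). *)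

theory Defs
  imports "HOL-Analysis.Analysis" "HOL-Library.Z2"
begin

type_synonym 'a iperm = "('a \<Rightarrow> nat) \<times> ('a \<Rightarrow> nat)"

abbreviation ptop :: "'a iperm \<Rightarrow> 'a \<Rightarrow> nat" where "ptop p \<equiv> fst p"
abbreviation pbot :: "'a iperm \<Rightarrow> 'a \<Rightarrow> nat" where "pbot p \<equiv> snd p"

definition is_perm :: "('a::finite) iperm \<Rightarrow> bool" where
  "is_perm p \<longleftrightarrow> bij_betw (ptop p) UNIV {1..CARD('a)} \<and> bij_betw (pbot p) UNIV {1..CARD('a)}"

definition atop :: "('a::finite) iperm \<Rightarrow> nat \<Rightarrow> 'a" where
  "atop p j = (THE a. ptop p a = j)"
definition abot :: "('a::finite) iperm \<Rightarrow> nat \<Rightarrow> 'a" where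
  "abot p j = (THE a. pbot p a = j)"

definition irreducible_perm :: "('a::finite) iperm \<Rightarrow> bool" where
  "irreducible_perm p \<longleftrightarrow>
     (\<forall>j. 1 \<le> j \<and> j < CARD('a) \<longrightarrow> ptop p -` {1..j} \<noteq> pbot p -` {1..j})"

definition nondegenerate_perm :: "('a::finite) iperm \<Rightarrow> bool" where
  "nondegenerate_perm p \<longleftrightarrow> \<not> (\<exists>j. 1 \<le> j \<and> j < CARD('a) \<and>
     ((pbot p (atop p j) = CARD('a) \<and> pbot p (atop p (j+1)) = 1 \<and>
         pbot p (atop p 1) = pbot p (atop p CARD('a)) + 1)
      \<or> (pbot p (atop p (j+1)) = 1 \<and> pbot p (atop p 1) = pbot p (atop p j) + 1)
      \<or> (pbot p (atop p j) = CARD('a) \<and> pbot p (atop p (j+1)) = pbot p (atop p CARD('a)) + 1)))"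

text \<open>Rauzy induction.  True = top operation, False = bottom operation.\<close>
definition shift_insert :: "nat \<Rightarrow> nat \<Rightarrow> nat \<Rightarrow> nat" where
  "shift_insert d k i = (if i \<le> k then i else if i = d then k + 1 else i + 1)"

definition rauzy_op :: "bool \<Rightarrow> ('a::finite) iperm \<Rightarrow> 'a iperm" where
  "rauzy_op c p =
     (if c then (ptop p, shift_insert CARD('a) (pbot p (atop p CARD('a))) \<circ> pbot p)
      else (shift_insert CARD('a) (ptop p (abot p CARD('a))) \<circ> ptop p, pbot p))"

definition winner :: "bool \<Rightarrow> ('a::finite) iperm \<Rightarrow> 'a" where
  "winner c p = (if c then atop p CARD('a) else abot p CARD('a))"
definition loser :: "bool \<Rightarrow> ('a::finite) iperm \<Rightarrow> 'a" where
  "loser c p = (if c then abot p CARD('a) else atop p CARD('a))"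

definition valid_perm :: "('a::finite) iperm \<Rightarrow> bool" where
  "valid_perm p \<longleftrightarrow> is_perm p \<and> irreducible_perm p"

definition rauzy_arrow :: "('a::finite) iperm \<Rightarrow> bool \<Rightarrow> 'a iperm \<Rightarrow> bool" where
  "rauzy_arrow p c q \<longleftrightarrow> valid_perm p \<and> valid_perm q \<and> q = rauzy_op c p"

definition rauzy_class :: "('a::finite) iperm \<Rightarrow> 'a iperm set" where
  "rauzy_class p = {q. (p, q) \<in> ({(x, y). \<exists>c. rauzy_arrow x c y} \<union> {(x, y). \<exists>c. rauzy_arrow y c x})\<^sup>*}"

definition Bmat :: "bool \<Rightarrow> ('a::finite) iperm \<Rightarrow> int^'a^'a" where
  "Bmat c p = (\<chi> i j. (if i = j then 1 else 0) + (if i = loser c p \<and> j = winner c p then 1 else 0))"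

inductive rv_walk :: "('a::finite) iperm \<Rightarrow> 'a iperm \<Rightarrow> int^'a^'a \<Rightarrow> bool" for p0 where
  nil: "rv_walk p0 p0 (mat 1)"
| fwd: "rv_walk p0 p1 M \<Longrightarrow> rauzy_arrow p1 c p2 \<Longrightarrow> rv_walk p0 p2 (Bmat c p1 ** M)"
| bwd: "rv_walk p0 p1 M \<Longrightarrow> rauzy_arrow p2 c p1 \<Longrightarrow> rv_walk p0 p2 (matrix_inv (Bmat c p2) ** M)"

definition RV :: "('a::finite) iperm \<Rightarrow> (int^'a^'a) set" where
  "RV p = {M. rv_walk p p M}"

definition Omega :: "('a::finite) iperm \<Rightarrow> int^'a^'a" where
  "Omega p = (\<chi> a b. if ptop p a < ptop p b \<and> pbot p a > pbot p b then 1
                     else if ptop p a > ptop p b \<and> pbot p a < pbot p b then -1 else 0)"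

definition Sp :: "('a::finite) iperm \<Rightarrow> (int^'a^'a) set" where
  "Sp p = {S. S ** Omega p ** transpose S = Omega p}"

definition red2 :: "int^'a^'b \<Rightarrow> bit^'a^'b" where
  "red2 S = (\<chi> i j. of_int (S $ i $ j))"

definition Qform :: "('a::finite) iperm \<Rightarrow> bit^'a \<Rightarrow> bit" where
  "Qform p u = (\<Sum>(a, b) \<in> {(a, b). ptop p a < ptop p b}. u $ a * of_int (Omega p $ a $ b) * u $ b)
               + (\<Sum>a\<in>UNIV. u $ a)"

definition OQ :: "('a::finite) iperm \<Rightarrow> (bit^'a^'a) set" where
  "OQ p = {S. invertible S \<and> (\<forall>u. Qform p (u v* S) = Qform p u)}"

text \<open>Veech's permutation sigma on {0..d} (d = CARD('a)), with
  m = pi_b o pi_t^{-1} the monodromy; its cycles correspond to the singularities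
  of the suspension surface.\<close>
definition mono :: "('a::finite) iperm \<Rightarrow> nat \<Rightarrow> nat" where
  "mono p j = pbot p (atop p j)"
definition mono_inv :: "('a::finite) iperm \<Rightarrow> nat \<Rightarrow> nat" where
  "mono_inv p j = ptop p (abot p j)"

definition sigma :: "('a::finite) iperm \<Rightarrow> nat \<Rightarrow> nat" where
  "sigma p j = (if j = 0 then mono_inv p 1 - 1
                else if j = mono_inv p CARD('a) then CARD('a)
                else mono_inv p (mono p j + 1) - 1)"

text \<open>M_p lies in the minimal stratum H(2g-2): a single singularity, i.e. sigma has
  a single cycle on {0..d}.\<close>
definition minimal_stratum :: "('a::finite) iperm \<Rightarrow> bool" where
  "minimal_stratum p \<longleftrightarrow> (\<forall>j \<le> CARD('a). \<exists>n. (sigma p ^^ n) 0 = j)"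

definition symmetric_perm :: "('a::finite) iperm \<Rightarrow> bool" where
  "symmetric_perm p \<longleftrightarrow> (\<forall>a. pbot p a = CARD('a) + 1 - ptop p a)"

definition hyperelliptic_class :: "('a::finite) iperm \<Rightarrow> bool" where
  "hyperelliptic_class p \<longleftrightarrow> (\<exists>q \<in> rauzy_class p. symmetric_perm q)"

end

theory Submission
  imports Defs
begin

text \<open>Every Rauzy class contains a standard permutation. For a standard permutation each basis vector
  \<open>e\<^sub>\<alpha>\<close> gives a transvection in the Rauzy--Veech group: turning the loop of top operations partially
  makes \<open>\<alpha>\<close> the last bottom letter before it has ever lost, and a full loop of bottom operations is then
  the transvection along \<open>e\<^sub>\<alpha>\<close>. What remains is a statement about the group \<open>\<Gamma>\<close> generated by these
  transvections in a unimodular symplectic lattice with a quadratic form \<open>q\<close> modulo 2.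

  The first and last top letters \<open>x0\<close>, \<open>y0\<close> of a standard permutation span a plane on which \<open>q\<close> is
  anisotropic modulo 2, and the vectors \<open>e\<^sub>\<alpha> - x0 - y0\<close> form a \<open>q\<close>-isotropic basis of its complement \<open>W\<close>.
  The set \<open>R\<close> of all \<open>w \<in> W\<close> such that the transvection along \<open>x0 + w\<close> lies in \<open>\<Gamma>\<close> is closed under sums
  of vectors with even pairing. The class not being hyperelliptic, the permutation is not symmetric, so two of
  the basis vectors of \<open>W\<close> have even pairing; this forces \<open>R\<close> to be the whole isotropic cone of \<open>W\<close>, since
  otherwise a shortest expression of an isotropic vector as a sum of elements of \<open>R\<close> would have length at least 4 and
  any two nonzero classes in \<open>R\<close> modulo 2 would pair oddly. Hence \<open>\<Gamma>\<close> contains the transvections along all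
  primitive \<open>v\<close> with \<open>q v\<close>. An isometry is then reduced to the identity by stripping off hyperbolic planes
  one at a time; the anisotropic plane is kept for last, which avoids the exceptional case of rank 4 and
  Arf invariant 0.\<close>

section \<open>Quadratic forms on unimodular lattices\<close>

text \<open>\<open>q u\<close> stands for value 1 of a quadratic form modulo 2, and the law for
  \<open>q\<close> is polarisation by \<open>\<omega>\<close>. The last axiom is unimodularity in
  divisibility form; for \<open>n = 0\<close> it gives nondegeneracy.\<close>

locale quadratic_lattice =
  fixes \<omega> :: "int^'n::finite \<Rightarrow> int^'n \<Rightarrow> int" and q :: "int^'n \<Rightarrow> bool"
  assumes add_left: "\<omega> (u + v) w = \<omega> u w + \<omega> v w"
    and scale_left: "\<omega> (k *s u) w = k * \<omega> u w"
    and skew: "\<omega> u v = - \<omega> v u"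
    and q_add: "q (u + v) \<longleftrightarrow> ((q u \<longleftrightarrow> q v) \<longleftrightarrow> odd (\<omega> u v))"
    and unimodular: "(\<And>x. n dvd \<omega> v x) \<Longrightarrow> \<exists>v'. v = n *s v'"
begin

lemma add_right: "\<omega> w (u + v) = \<omega> w u + \<omega> w v"
  by (metis add_left skew minus_add_distrib)

lemma scale_right: "\<omega> w (k *s u) = k * \<omega> w u"
  by (metis scale_left skew mult_minus_right)

lemma self [simp]: "\<omega> u u = 0"
  using skew[of u u] by simp

lemma minus_left: "\<omega> (- u) w = - \<omega> u w"
  using scale_left[of "-1" u w] by (simp add: vector_sneg_minus1[symmetric])

lemma minus_right: "\<omega> w (- u) = - \<omega> w u"
  using scale_right[of w "-1" u] by (simp add: vector_sneg_minus1[symmetric])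

lemma diff_left: "\<omega> (u - v) w = \<omega> u w - \<omega> v w"
  using add_left[of u "-v" w] by (simp add: minus_left)

lemma diff_right: "\<omega> w (u - v) = \<omega> w u - \<omega> w v"
  using add_right[of w u "-v"] by (simp add: minus_right)

lemma zero_left [simp]: "\<omega> 0 w = 0" and zero_right [simp]: "\<omega> w 0 = 0"
  using scale_left[of 0 0 w] scale_right[of w 0 0] by simp_all

lemmas bilinear = add_left add_right scale_left scale_right minus_left minus_right diff_left diff_right

lemma q_zero [simp]: "\<not> q 0"
  using q_add[of 0 0] by simp

lemma q_even: "even k \<Longrightarrow> \<not> q (k *s u)"
proof -
  assume "even k"
  then obtain m where "k = m + m" by (metis evenE mult_2)
  then have "k *s u = m *s u + m *s u" by (simp only: vector_sadd_rdistrib)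
  then show ?thesis using q_add[of "m *s u" "m *s u"] by simp
qed

lemma q_scale: "q (k *s u) \<longleftrightarrow> odd k \<and> q u"
proof (cases "even k")
  case False
  then have "k *s u = (k - 1) *s u + u" by (simp add: vec_eq_iff algebra_simps)
  then have "q (k *s u) \<longleftrightarrow> ((q ((k - 1) *s u) \<longleftrightarrow> q u) \<longleftrightarrow> odd (\<omega> ((k - 1) *s u) u))"
    using q_add[of "(k - 1) *s u" u] by (simp only:)
  moreover have "\<not> q ((k - 1) *s u)" using False by (intro q_even) simp
  ultimately show ?thesis using False by (simp add: scale_left diff_left)
qed (simp add: q_even)

lemma q_minus [simp]: "q (- u) \<longleftrightarrow> q u"
  using q_scale[of "-1" u] by (simp add: vector_sneg_minus1[symmetric])

lemma q_diff: "q (u - v) \<longleftrightarrow> ((q u \<longleftrightarrow> q v) \<longleftrightarrow> odd (\<omega> u v))"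
  using q_add[of u "-v"] by (simp add: minus_right)

lemmas q_simps = q_add q_scale q_diff

lemma nondegenerate: "(\<And>x. \<omega> v x = 0) \<Longrightarrow> v = 0"
  using unimodular[of 0 v] by auto

text \<open>The least positive value of \<open>\<omega> v\<close> divides all its values by division
  with remainder, so unimodularity allows \<open>v\<close> to be divided by it. The quotient then
  attains the value 1.\<close>

lemma primitive_multiple:
  assumes "v \<noteq> 0"
  obtains n v' x where "v = n *s v'" "n \<noteq> 0" "\<omega> v' x = 1"
proof -
  define P where "P = (\<lambda>m::nat. m > 0 \<and> (\<exists>x. \<omega> v x = int m))"
  have "\<exists>m. P m"
  proof -
    obtain x where x: "\<omega> v x \<noteq> 0" using nondegenerate assms by blast
    have "\<omega> v (sgn (\<omega> v x) *s x) = int (nat \<bar>\<omega> v x\<bar>)"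
      by (simp add: scale_right sgn_if)
    moreover have "nat \<bar>\<omega> v x\<bar> > 0" using x by simp
    ultimately show ?thesis unfolding P_def by blast
  qed
  then have Pn: "P (Least P)" by (rule LeastI_ex)
  define n where "n = Least P"
  obtain x where n0: "n > 0" and x: "\<omega> v x = int n" using Pn unfolding P_def n_def by blast
  have "int n dvd \<omega> v y" for y
  proof -
    have "\<omega> v (y - (\<omega> v y div int n) *s x) = \<omega> v y mod int n"
      by (simp add: bilinear x minus_div_mult_eq_mod)
    moreover have "\<omega> v y mod int n = int (nat (\<omega> v y mod int n))" using n0 by simp
    ultimately have "P (nat (\<omega> v y mod int n))" if "\<omega> v y mod int n \<noteq> 0"
      unfolding P_def using that n0 by (metis gr0I of_nat_0)
    moreover have "nat (\<omega> v y mod int n) < n" using n0 by (simp add: nat_less_iff)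
    then have "\<not> P (nat (\<omega> v y mod int n))" unfolding n_def by (rule not_less_Least)
    ultimately have "\<omega> v y mod int n = 0" by blast
    then show ?thesis by auto
  qed
  then obtain v' where v': "v = int n *s v'" using unimodular by blast
  have "\<omega> v' x = 1" using x n0 unfolding v' by (simp add: scale_left)
  then show ?thesis using that v' n0 by simp
qed

definition perp :: "(int^'n) set \<Rightarrow> (int^'n) set" where
  "perp F = {v. \<forall>x\<in>F. \<omega> v x = 0}"

lemma perpD: "v \<in> perp F \<Longrightarrow> x \<in> F \<Longrightarrow> \<omega> v x = 0"
  and perpD': "v \<in> perp F \<Longrightarrow> x \<in> F \<Longrightarrow> \<omega> x v = 0"
  unfolding perp_def using skew[of x v] by auto

lemma perp_closed:
  "0 \<in> perp F" "u \<in> perp F \<Longrightarrow> v \<in> perp F \<Longrightarrow> u + v \<in> perp F"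
  "u \<in> perp F \<Longrightarrow> v \<in> perp F \<Longrightarrow> u - v \<in> perp F" "u \<in> perp F \<Longrightarrow> - u \<in> perp F"
  "u \<in> perp F \<Longrightarrow> k *s u \<in> perp F"
  by (simp_all add: perp_def bilinear)

lemma perp_Un: "perp (F \<union> G) = perp F \<inter> perp G"
  by (auto simp: perp_def)

lemma perp_sym: "F \<subseteq> perp G \<longleftrightarrow> G \<subseteq> perp F"
proof -
  have "\<omega> v x = 0 \<longleftrightarrow> \<omega> x v = 0" for v x using skew[of x v] by auto
  then show ?thesis unfolding perp_def by blast
qed

definition isometry :: "(int^'n \<Rightarrow> int^'n) \<Rightarrow> bool" where
  "isometry f \<longleftrightarrow> bij f \<and> (\<forall>u v. f (u + v) = f u + f v) \<and> (\<forall>k u. f (k *s u) = k *s f u) \<and>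
     (\<forall>u v. \<omega> (f u) (f v) = \<omega> u v) \<and> (\<forall>u. q (f u) \<longleftrightarrow> q u)"

lemma isometryD:
  assumes "isometry f"
  shows "bij f" "f (u + v) = f u + f v" "f (k *s u) = k *s f u"
    "\<omega> (f u) (f v) = \<omega> u v" "q (f u) \<longleftrightarrow> q u" "f (inv f u) = u" "inv f (f u) = u"
  using assms unfolding isometry_def
  by (auto simp: bij_is_surj bij_is_inj surj_f_inv_f)

lemma isometry_comp: "isometry f \<Longrightarrow> isometry g \<Longrightarrow> isometry (f \<circ> g)"
  unfolding isometry_def by (auto intro: bij_comp)

definition transv :: "int^'n \<Rightarrow> int^'n \<Rightarrow> int^'n" where
  "transv v x = x + \<omega> x v *s v"

lemma transv_inverse: "transv v (x - \<omega> x v *s v) = x" "transv v x - \<omega> (transv v x) v *s v = x"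
  by (simp_all add: transv_def bilinear)

lemma inv_transv: "inv (transv v) x = x - \<omega> x v *s v"
proof (rule inv_f_eq)
  show "inj (transv v)" by (rule inj_on_inverseI) (rule transv_inverse(2))
qed (rule transv_inverse(1))

end

locale isometry_group = quadratic_lattice \<omega> q
  for \<omega> :: "int^'n::finite \<Rightarrow> int^'n \<Rightarrow> int" and q +
  fixes \<Gamma> :: "(int^'n \<Rightarrow> int^'n) set"
  assumes iso: "f \<in> \<Gamma> \<Longrightarrow> isometry f"
    and id_mem: "id \<in> \<Gamma>"
    and comp_mem: "f \<in> \<Gamma> \<Longrightarrow> g \<in> \<Gamma> \<Longrightarrow> f \<circ> g \<in> \<Gamma>"
    and inv_mem: "f \<in> \<Gamma> \<Longrightarrow> inv f \<in> \<Gamma>"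
begin

definition \<Delta> :: "(int^'n) set" where "\<Delta> = {v. transv v \<in> \<Gamma>}"

text \<open>Working with pointwise stabilisers lets each later reduction leave the planes already
  treated untouched.\<close>

definition stab :: "(int^'n) set \<Rightarrow> (int^'n \<Rightarrow> int^'n) set" where
  "stab F = {f \<in> \<Gamma>. \<forall>x\<in>F. f x = x}"

lemma stab_iso: "f \<in> stab F \<Longrightarrow> isometry f"
  by (simp add: stab_def iso)

lemma stab_id: "id \<in> stab F"
  by (simp add: stab_def id_mem)

lemma stab_comp: "f \<in> stab F \<Longrightarrow> g \<in> stab F \<Longrightarrow> f \<circ> g \<in> stab F"
  by (simp add: stab_def comp_mem)

lemma stab_inv: "f \<in> stab F \<Longrightarrow> inv f \<in> stab F"
proof -
  assume f: "f \<in> stab F"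
  then have "inv f x = x" if "x \<in> F" for x
    using isometryD(7)[OF stab_iso[OF f], of x] that by (simp add: stab_def)
  then show ?thesis using f inv_mem by (simp add: stab_def)
qed

lemma stab_mono: "F \<subseteq> G \<Longrightarrow> stab G \<subseteq> stab F"
  by (auto simp: stab_def)

lemma stab_perp: "f \<in> stab F \<Longrightarrow> v \<in> perp F \<Longrightarrow> f v \<in> perp F"
proof -
  assume f: "f \<in> stab F" and v: "v \<in> perp F"
  have "\<omega> (f v) x = 0" if "x \<in> F" for x
    using isometryD(4)[OF stab_iso[OF f], of v x] f v that by (simp add: perpD stab_def)
  then show ?thesis by (simp add: perp_def)
qed

lemma transv_stab: "u \<in> \<Delta> \<Longrightarrow> u \<in> perp F \<Longrightarrow> transv u \<in> stab F"
  unfolding stab_def \<Delta>_def by (auto simp: transv_def perpD')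

text \<open>Conjugating a transvection by an isometry \<open>f\<close> gives the transvection along
  the image vector.\<close>

lemma \<Delta>_image:
  assumes f: "f \<in> \<Gamma>" and v: "v \<in> \<Delta>"
  shows "f v \<in> \<Delta>"
proof -
  note i = isometryD[OF iso[OF f]]
  have "transv (f v) = f \<circ> (transv v \<circ> inv f)"
  proof
    fix x
    have "\<omega> (inv f x) v = \<omega> x (f v)" using i(4)[of "inv f x" v] i(6) by simp
    then show "transv (f v) x = (f \<circ> (transv v \<circ> inv f)) x" by (simp add: transv_def i)
  qed
  then show ?thesis using f v comp_mem inv_mem unfolding \<Delta>_def by simp
qed

lemma \<Delta>_image_iff: "f \<in> \<Gamma> \<Longrightarrow> f v \<in> \<Delta> \<longleftrightarrow> v \<in> \<Delta>"
  using \<Delta>_image[of "inv f" "f v"] \<Delta>_image[of f v] inv_mem isometryD(7)[OF iso, of f v] by auto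

lemma \<Delta>_minus: "v \<in> \<Delta> \<Longrightarrow> - v \<in> \<Delta>"
proof -
  have "transv (- v) = transv v"
    by (auto simp: transv_def bilinear fun_eq_iff vec_eq_iff)
  then show "v \<in> \<Delta> \<Longrightarrow> - v \<in> \<Delta>" by (simp add: \<Delta>_def)
qed

text \<open>Up to the sign of the pairing, \<open>u + v\<close> is the image of \<open>u\<close>
  under \<open>transv v\<close> or its inverse, so \<open>\<Delta>_image\<close> applies.\<close>

lemma \<Delta>_add: "u \<in> \<Delta> \<Longrightarrow> v \<in> \<Delta> \<Longrightarrow> \<bar>\<omega> u v\<bar> = 1 \<Longrightarrow> u + v \<in> \<Delta>"
proof -
  assume u: "u \<in> \<Delta>" and v: "v \<in> \<Delta>" and "\<bar>\<omega> u v\<bar> = 1"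
  then consider "\<omega> u v = 1" | "\<omega> u v = -1" by linarith
  then show ?thesis
  proof cases
    case 1
    then have "transv v u = u + v" by (simp add: transv_def)
    then show ?thesis using \<Delta>_image[of "transv v" u] u v unfolding \<Delta>_def by simp
  next
    case 2
    then have "inv (transv v) u = u + v" by (simp add: inv_transv vector_sneg_minus1[symmetric])
    then show ?thesis using \<Delta>_image[of "inv (transv v)" u] inv_mem u v unfolding \<Delta>_def by simp
  qed
qed

end

section \<open>Groups containing many transvections\<close>

lemma size_eq_SucD: "size M = Suc n \<Longrightarrow> \<exists>a N. M = add_mset a N \<and> size N = n"
  by (metis size_eq_Suc_imp_eq_union size_add_mset nat.inject)

inductive_set int_span :: "(int^'n::finite) set \<Rightarrow> (int^'n) set" for B where
  zero: "0 \<in> int_span B"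
| add: "s \<in> int_span B \<Longrightarrow> b \<in> B \<Longrightarrow> s + b \<in> int_span B"
| diff: "s \<in> int_span B \<Longrightarrow> b \<in> B \<Longrightarrow> s - b \<in> int_span B"

text \<open>Since \<open>q\<close> is 1 on \<open>x0\<close>, on \<open>y0\<close> and hence on
  \<open>x0 + y0\<close>, the plane is anisotropic modulo 2. Its two transvections act on it as
  elementary generators of SL(2, Z) and fix the complement \<open>W\<close> pointwise.\<close>

locale plane_monodromy = isometry_group \<omega> q \<Gamma>
  for \<omega> :: "int^'n::finite \<Rightarrow> int^'n \<Rightarrow> int" and q and \<Gamma> +
  fixes x0 y0 :: "int^'n"
  assumes xy: "\<omega> x0 y0 = 1" and qx: "q x0" and qy: "q y0" and x\<Delta>: "x0 \<in> \<Delta>" and y\<Delta>: "y0 \<in> \<Delta>"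
begin

abbreviation W :: "(int^'n) set" where "W \<equiv> perp {x0, y0}"

lemma yx: "\<omega> y0 x0 = -1"
  using skew[of y0 x0] xy by simp

lemma W_D: "w \<in> W \<Longrightarrow> \<omega> w x0 = 0" "w \<in> W \<Longrightarrow> \<omega> w y0 = 0" "w \<in> W \<Longrightarrow> \<omega> x0 w = 0" "w \<in> W \<Longrightarrow> \<omega> y0 w = 0"
  by (auto dest: perpD perpD')

lemmas plane = bilinear xy yx W_D

lemma \<Gamma>_transv: "transv x0 \<in> stab W" "transv y0 \<in> stab W"
  using transv_stab[of x0 W] transv_stab[of y0 W] x\<Delta> y\<Delta> perp_sym[of "{x0,y0}" W] by auto

lemma stab_W_plane: "f \<in> stab W \<Longrightarrow> w \<in> W \<Longrightarrow> f (u + w) = f u + w"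
  using isometryD(2)[OF stab_iso, of f W u w] by (simp add: stab_def)

lemma plane_transv:
  "transv x0 (i *s x0 + j *s y0) = (i - j) *s x0 + j *s y0"
  "inv (transv x0) (i *s x0 + j *s y0) = (i + j) *s x0 + j *s y0"
  "transv y0 (i *s x0 + j *s y0) = i *s x0 + (j + i) *s y0"
  "inv (transv y0) (i *s x0 + j *s y0) = i *s x0 + (j - i) *s y0"
  by (simp_all add: transv_def inv_transv plane vec_eq_iff algebra_simps)

lemma euclid_axis: "\<exists>f\<in>stab W. f (i *s x0) = \<bar>i\<bar> *s x0"
proof (cases "i \<ge> 0")
  case True
  then show ?thesis by (intro bexI[of _ id]) (auto simp: stab_id)
next
  case False
  \<comment> \<open>On coordinates this runs through (i, 0), (i, i), (0, i), (-i, i), (-i, 0), so it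
    changes the sign.\<close>
  let ?f = "transv y0 \<circ> (transv x0 \<circ> (transv x0 \<circ> transv y0))"
  have "?f (i *s x0 + 0 *s y0) = (- i) *s x0 + 0 *s y0"
    unfolding comp_apply plane_transv by simp
  then have "?f (i *s x0) = \<bar>i\<bar> *s x0" using False by simp
  moreover have "?f \<in> stab W" by (intro stab_comp \<Gamma>_transv)
  ultimately show ?thesis by blast
qed

text \<open>Euclid's algorithm carried out by the two transvections: the entry of smaller absolute
  value is subtracted from the other when the signs agree and added when they differ, so the sum of
  absolute values drops.\<close>

lemma euclid: "\<exists>f\<in>stab W. f (i *s x0 + j *s y0) = gcd i j *s x0"
proof (induction "nat (\<bar>i\<bar> + \<bar>j\<bar>)" arbitrary: i j rule: less_induct)
  case less
  have step: ?case if g: "g \<in> stab W" and "g (i *s x0 + j *s y0) = i' *s x0 + j' *s y0"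
    and "gcd i' j' = gcd i j" "\<bar>i'\<bar> + \<bar>j'\<bar> < \<bar>i\<bar> + \<bar>j\<bar>" for g i' j'
  proof -
    have "nat (\<bar>i'\<bar> + \<bar>j'\<bar>) < nat (\<bar>i\<bar> + \<bar>j\<bar>)" using that(4) by linarith
    from less[OF this] obtain f where f: "f \<in> stab W" "f (i' *s x0 + j' *s y0) = gcd i' j' *s x0"
      by blast
    then have "(f \<circ> g) (i *s x0 + j *s y0) = gcd i j *s x0" using that by simp
    then show ?thesis using stab_comp[OF f(1) g] by blast
  qed
  consider "j = 0" | "i = 0" | "j \<noteq> 0" "i \<noteq> 0" by blast
  then show ?case
  proof cases
    case 1
    then show ?thesis using euclid_axis[of i] by simp
  next
    case 2
    obtain f where f: "f \<in> stab W" "f (j *s x0) = \<bar>j\<bar> *s x0" using euclid_axis by blast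
    \<comment> \<open>A multiple of \<open>y0\<close> becomes the same multiple of
      \<open>x0\<close>, which is the case already settled by \<open>euclid_axis\<close>.\<close>
    have "(inv (transv y0) \<circ> inv (transv x0)) (0 *s x0 + j *s y0) = j *s x0 + 0 *s y0"
      unfolding comp_apply plane_transv by simp
    then have "(f \<circ> (inv (transv y0) \<circ> inv (transv x0))) (0 *s x0 + j *s y0) = \<bar>j\<bar> *s x0"
      using f by simp
    moreover have "f \<circ> (inv (transv y0) \<circ> inv (transv x0)) \<in> stab W"
      by (intro stab_comp stab_inv \<Gamma>_transv f)
    ultimately show ?thesis using 2 by (metis gcd_0_left_int)
  next
    case 3
    consider "sgn i = sgn j" "\<bar>i\<bar> \<ge> \<bar>j\<bar>" | "sgn i = sgn j" "\<bar>i\<bar> < \<bar>j\<bar>"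
      | "sgn i \<noteq> sgn j" "\<bar>i\<bar> \<ge> \<bar>j\<bar>" | "sgn i \<noteq> sgn j" "\<bar>i\<bar> < \<bar>j\<bar>" by linarith
    then show ?thesis
    proof cases
      case 1
      then show ?thesis using 3
        by (intro step[OF \<Gamma>_transv(1) plane_transv(1)])
          (auto simp: gcd_diff1 sgn_if abs_if split: if_splits)
    next
      case 2
      have "gcd i (j - i) = gcd i j" by (metis gcd.commute gcd_diff1)
      then show ?thesis using 3 2
        by (intro step[OF stab_inv[OF \<Gamma>_transv(2)] plane_transv(4)])
          (auto simp: sgn_if abs_if split: if_splits)
    next
      case 3
      then show ?thesis using \<open>j \<noteq> 0\<close> \<open>i \<noteq> 0\<close>
        by (intro step[OF stab_inv[OF \<Gamma>_transv(1)] plane_transv(2)])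
          (auto simp: sgn_if abs_if split: if_splits)
    next
      case 4
      have "gcd i (j + i) = gcd i j" by (metis gcd.commute gcd_add1)
      then show ?thesis using 3 4
        by (intro step[OF \<Gamma>_transv(2) plane_transv(3)])
          (auto simp: sgn_if abs_if split: if_splits)
    qed
  qed
qed

definition R :: "(int^'n) set" where "R = {w \<in> W. \<not> q w \<and> x0 + w \<in> \<Delta>}"

lemma R_D: "w \<in> R \<Longrightarrow> w \<in> W" "w \<in> R \<Longrightarrow> \<not> q w"
  by (simp_all add: R_def)

text \<open>An element of \<open>stab W\<close> brings any primitive plane vector to
  \<open>x0\<close> without touching \<open>w\<close>. Hence the plane component in the definition
  of \<open>R\<close> may be chosen freely among primitive vectors.\<close>

lemma R_iff:
  assumes "coprime i j" "w \<in> W"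
  shows "i *s x0 + j *s y0 + w \<in> \<Delta> \<longleftrightarrow> x0 + w \<in> \<Delta>"
proof -
  obtain f where f: "f \<in> stab W" "f (i *s x0 + j *s y0) = x0" using euclid[of i j] assms(1) by auto
  then have "f (i *s x0 + j *s y0 + w) = x0 + w" using stab_W_plane[OF f(1) assms(2)] by simp
  then show ?thesis using \<Delta>_image_iff[of f] f(1) by (metis (no_types, lifting) mem_Collect_eq stab_def)
qed

lemma R_zero: "0 \<in> R"
  by (simp add: R_def perp_closed x\<Delta>)

lemma R_minus: "w \<in> R \<Longrightarrow> - w \<in> R"
proof -
  assume w: "w \<in> R"
  then have "(-1) *s x0 + 0 *s y0 + - w \<in> \<Delta>"
    using \<Delta>_minus[of "x0 + w"] by (simp add: R_def vector_sneg_minus1[symmetric])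
  then show ?thesis using R_iff[of "-1" 0 "-w"] w by (simp add: R_def perp_closed)
qed

text \<open>By \<open>R_iff\<close> the second vector may be given plane part
  \<open>x0 + k *s y0\<close>, with \<open>k\<close> chosen to make its pairing with
  \<open>x0 + w\<close> equal to 1. The sum lies in \<open>\<Delta>\<close> by
  \<open>\<Delta>_add\<close>, and its plane part \<open>2 *s x0 + k *s y0\<close> is primitive
  because even pairing makes \<open>k\<close> odd.\<close>

lemma R_add:
  assumes w: "w \<in> R" and w': "w' \<in> R" and even: "even (\<omega> w w')"
  shows "w + w' \<in> R"
proof -
  define k where "k = 1 - \<omega> w w'"
  have W: "w \<in> W" "w' \<in> W" using w w' by (simp_all add: R_def)
  have "1 *s x0 + k *s y0 + w' \<in> \<Delta>" using R_iff[of 1 k w'] w' by (simp add: R_def)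
  moreover have "\<omega> (x0 + w) (1 *s x0 + k *s y0 + w') = 1" using W by (simp add: plane k_def)
  ultimately have "(x0 + w) + (1 *s x0 + k *s y0 + w') \<in> \<Delta>"
    using w by (intro \<Delta>_add[of "x0 + w"]) (simp_all add: R_def)
  moreover have "(x0 + w) + (1 *s x0 + k *s y0 + w') = 2 *s x0 + k *s y0 + (w + w')"
    by (simp add: vec_eq_iff algebra_simps)
  moreover have "coprime 2 k" using even by (simp add: k_def)
  ultimately have "x0 + (w + w') \<in> \<Delta>" using R_iff[of 2 k "w + w'"] W perp_closed(2) by metis
  then show ?thesis using w w' even W by (simp add: R_def perp_closed q_add)
qed

lemma R_diff: "w \<in> R \<Longrightarrow> w' \<in> R \<Longrightarrow> even (\<omega> w w') \<Longrightarrow> w - w' \<in> R"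
  using R_add[of w "-w'"] R_minus[of w'] by (simp add: minus_right)

section \<open>Shortest expressions as sums of elements of \<open>R\<close>\<close>

definition minimal :: "(int^'n) multiset \<Rightarrow> bool" where
  "minimal M \<longleftrightarrow> set_mset M \<subseteq> R \<and>
     (\<forall>N. set_mset N \<subseteq> R \<and> \<Sum>\<^sub># N = \<Sum>\<^sub># M \<longrightarrow> size M \<le> size N)"

lemma minimalD: "minimal M \<Longrightarrow> r \<in># M \<Longrightarrow> r \<in> R"
  "minimal M \<Longrightarrow> set_mset N \<subseteq> R \<Longrightarrow> \<Sum>\<^sub># N = \<Sum>\<^sub># M \<Longrightarrow> size M \<le> size N"
  by (auto simp: minimal_def)

text \<open>Two terms with even pairing could be merged into one by \<open>R_add\<close>.\<close>

lemma minimal_odd: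
  assumes "minimal M" "M = add_mset r (add_mset r' N)"
  shows "odd (\<omega> r r')"
proof
  assume "even (\<omega> r r')"
  then have "r + r' \<in> R" using assms minimalD(1) by (intro R_add) auto
  then have "size M \<le> size (add_mset (r + r') N)"
    using assms minimalD(1)[OF assms(1)] by (intro minimalD(2)[OF assms(1)]) (auto simp: add_ac)
  then show False using assms by simp
qed

text \<open>Otherwise \<open>r1\<close>, \<open>r2\<close>, \<open>r3\<close> could be replaced by the two elements \<open>r1 - s + r3\<close> and \<open>s + r2\<close>.\<close>
lemma minimal_parity:
  assumes min: "minimal M" "M = add_mset r1 (add_mset r2 (add_mset r3 N))"
    and s: "s \<in> R" "even (\<omega> s r1)" "even (\<omega> s r2)"
  shows "even (\<omega> s r3)"
proof (rule ccontr)
  assume odd: "odd (\<omega> s r3)"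
  have r: "r1 \<in> R" "r2 \<in> R" "r3 \<in> R" using min minimalD(1)[OF min(1)] by auto
  have "odd (\<omega> r1 r3)" using minimal_odd[OF min(1), of r1 r3 "add_mset r2 N"] min(2)
    by (simp add: add_mset_commute)
  moreover have "r1 - s \<in> R" using r s skew[of r1 s] by (intro R_diff) auto
  ultimately have a: "r1 - s + r3 \<in> R" using r odd by (intro R_add) (auto simp: bilinear)
  have "s + r2 \<in> R" using r s by (intro R_add)
  then have "size M \<le> size (add_mset (r1 - s + r3) (add_mset (s + r2) N))"
    using min a minimalD(1)[OF min(1)] by (intro minimalD(2)[OF min(1)]) (auto simp: algebra_simps)
  then show False using min by simp
qed

text \<open>Moving \<open>t\<close> from one term to another keeps the sum and the length; the
  evenness conditions keep both terms in \<open>R\<close>.\<close>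

lemma minimal_flip:
  assumes min: "minimal M" "M = add_mset r1 (add_mset r2 N)"
    and t: "t \<in> R" "even (\<omega> t r1)" "even (\<omega> t r2)"
  shows "minimal (add_mset (r1 + t) (add_mset (r2 - t) N))"
proof -
  have r: "r1 \<in> R" "r2 \<in> R" "set_mset N \<subseteq> R" using min minimalD(1)[OF min(1)] by auto
  have "r1 + t \<in> R" "r2 - t \<in> R" using r t skew[of r1 t] skew[of r2 t]
    by (auto intro: R_add R_diff)
  moreover have "\<Sum>\<^sub># (add_mset (r1 + t) (add_mset (r2 - t) N)) = \<Sum>\<^sub># M"
    using min by (simp add: algebra_simps)
  moreover have "size (add_mset (r1 + t) (add_mset (r2 - t) N)) = size M" using min by simp
  ultimately show ?thesis using r min(1) unfolding minimal_def by simp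
qed

text \<open>By \<open>minimal_parity\<close>, of four terms of a minimal sum either 0, 1 or 4 pair
  evenly with \<open>b\<close>. If \<open>b\<close> paired oddly with \<open>t\<close>, flipping two
  suitable terms by \<open>t\<close> would change exactly these two parities and produce 2 or 3 even
  pairings in another minimal sum.\<close>

lemma minimal_four:
  assumes min: "minimal M" "M = add_mset r1 (add_mset r2 (add_mset r3 (add_mset r4 N)))"
    and t: "t \<in> R" "even (\<omega> t r1)" "even (\<omega> t r2)" "even (\<omega> t r3)" "even (\<omega> t r4)" and b: "b \<in> R"
  shows "even (\<omega> b t)"
proof (rule ccontr)
  assume odd: "odd (\<omega> b t)"
  \<comment> \<open>Flips among \<open>r1\<close>, \<open>r2\<close>, \<open>r3\<close> suffice: if
    at most one of the four terms pairs evenly with \<open>b\<close>, two of these three pair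
    oddly.\<close>
  have m12: "minimal (add_mset (r1 + t) (add_mset (r2 - t) (add_mset r3 (add_mset r4 N))))"
    using minimal_flip[OF min t(1-3)] .
  have m13: "minimal (add_mset (r1 + t) (add_mset (r3 - t) (add_mset r2 (add_mset r4 N))))"
    using minimal_flip[OF min(1) _ t(1,2,4), of "add_mset r2 (add_mset r4 N)"] min(2)
    by (simp add: add_mset_commute)
  have m23: "minimal (add_mset (r2 + t) (add_mset (r3 - t) (add_mset r1 (add_mset r4 N))))"
    using minimal_flip[OF min(1) _ t(1,3,4), of "add_mset r1 (add_mset r4 N)"] min(2)
    by (simp add: add_mset_commute)
  have two: "even (\<omega> b a3) \<and> even (\<omega> b a4)"
    if "minimal M'" "M' = add_mset a1 (add_mset a2 (add_mset a3 (add_mset a4 N)))"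
      "even (\<omega> b a1)" "even (\<omega> b a2)" for M' a1 a2 a3 a4
    using minimal_parity[OF that(1) _ b that(3,4), of a3 "add_mset a4 N"]
      minimal_parity[OF that(1) _ b that(3,4), of a4 "add_mset a3 N"] that(2)
    by (simp add: add_mset_commute)
  have e: "even (\<omega> b (r + t)) \<longleftrightarrow> odd (\<omega> b r)" "even (\<omega> b (r - t)) \<longleftrightarrow> odd (\<omega> b r)" for r
    using odd by (simp_all add: bilinear)
  have b12: "even (\<omega> b r1) \<Longrightarrow> even (\<omega> b r2) \<Longrightarrow> even (\<omega> b r3) \<and> even (\<omega> b r4)"
    by (rule two[OF min(1), of r1 r2 r3 r4]) (simp_all add: min(2) add_mset_commute)
  have b13: "even (\<omega> b r1) \<Longrightarrow> even (\<omega> b r3) \<Longrightarrow> even (\<omega> b r2) \<and> even (\<omega> b r4)"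
    by (rule two[OF min(1), of r1 r3 r2 r4]) (simp_all add: min(2) add_mset_commute)
  have b14: "even (\<omega> b r1) \<Longrightarrow> even (\<omega> b r4) \<Longrightarrow> even (\<omega> b r2) \<and> even (\<omega> b r3)"
    by (rule two[OF min(1), of r1 r4 r2 r3]) (simp_all add: min(2) add_mset_commute)
  have b23: "even (\<omega> b r2) \<Longrightarrow> even (\<omega> b r3) \<Longrightarrow> even (\<omega> b r1) \<and> even (\<omega> b r4)"
    by (rule two[OF min(1), of r2 r3 r1 r4]) (simp_all add: min(2) add_mset_commute)
  have b24: "even (\<omega> b r2) \<Longrightarrow> even (\<omega> b r4) \<Longrightarrow> even (\<omega> b r1) \<and> even (\<omega> b r3)"
    by (rule two[OF min(1), of r2 r4 r1 r3]) (simp_all add: min(2) add_mset_commute)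
  have b34: "even (\<omega> b r3) \<Longrightarrow> even (\<omega> b r4) \<Longrightarrow> even (\<omega> b r1) \<and> even (\<omega> b r2)"
    by (rule two[OF min(1), of r3 r4 r1 r2]) (simp_all add: min(2) add_mset_commute)
  have f12: "odd (\<omega> b r1) \<Longrightarrow> odd (\<omega> b r2) \<Longrightarrow> even (\<omega> b r3) \<and> even (\<omega> b r4)"
    using two[OF m12 refl] unfolding e .
  have h12: "even (\<omega> b r3) \<Longrightarrow> even (\<omega> b r4) \<Longrightarrow> odd (\<omega> b r1) \<and> odd (\<omega> b r2)"
    using two[OF m12, of r3 r4 "r1 + t" "r2 - t"] unfolding e by (simp add: add_mset_commute)
  have g12: "odd (\<omega> b r1) \<Longrightarrow> even (\<omega> b r4) \<Longrightarrow> odd (\<omega> b r2) \<and> even (\<omega> b r3)"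
    using two[OF m12, of "r1 + t" r4 "r2 - t" r3] unfolding e by (simp add: add_mset_commute)
  have g21: "odd (\<omega> b r2) \<Longrightarrow> even (\<omega> b r4) \<Longrightarrow> odd (\<omega> b r1) \<and> even (\<omega> b r3)"
    using two[OF m12, of "r2 - t" r4 "r1 + t" r3] unfolding e by (simp add: add_mset_commute)
  have f13: "odd (\<omega> b r1) \<Longrightarrow> odd (\<omega> b r3) \<Longrightarrow> even (\<omega> b r2) \<and> even (\<omega> b r4)"
    using two[OF m13 refl] unfolding e .
  have g13: "odd (\<omega> b r1) \<Longrightarrow> even (\<omega> b r4) \<Longrightarrow> odd (\<omega> b r3) \<and> even (\<omega> b r2)"
    using two[OF m13, of "r1 + t" r4 "r3 - t" r2] unfolding e by (simp add: add_mset_commute)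
  have g31: "odd (\<omega> b r3) \<Longrightarrow> even (\<omega> b r4) \<Longrightarrow> odd (\<omega> b r1) \<and> even (\<omega> b r2)"
    using two[OF m13, of "r3 - t" r4 "r1 + t" r2] unfolding e by (simp add: add_mset_commute)
  have f23: "odd (\<omega> b r2) \<Longrightarrow> odd (\<omega> b r3) \<Longrightarrow> even (\<omega> b r1) \<and> even (\<omega> b r4)"
    using two[OF m23 refl] unfolding e .
  have g23: "odd (\<omega> b r2) \<Longrightarrow> even (\<omega> b r4) \<Longrightarrow> odd (\<omega> b r3) \<and> even (\<omega> b r1)"
    using two[OF m23, of "r2 + t" r4 "r3 - t" r1] unfolding e by (simp add: add_mset_commute)
  have g32: "odd (\<omega> b r3) \<Longrightarrow> even (\<omega> b r4) \<Longrightarrow> odd (\<omega> b r2) \<and> even (\<omega> b r1)"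
    using two[OF m23, of "r3 - t" r4 "r2 + t" r1] unfolding e by (simp add: add_mset_commute)
  show False
    using h12 b12 b13 b14 b23 b24 b34 f12 f13 f23 g12 g21 g13 g31 g23 g32 by blast
qed

text \<open>With four or more terms, each of \<open>c\<close> and \<open>d\<close> agrees modulo 2
  with a term or pairs oddly with every term. Distinct terms pair oddly, so the even pairing of
  \<open>c\<close> and \<open>d\<close> leaves only the possibility that \<open>c - d\<close> pairs
  evenly with all of \<open>R\<close>, which is excluded. Congruence modulo 2 is expressed through
  pairings with \<open>R\<close>.\<close>

lemma minimal_size:
  assumes min: "minimal M"
    and c: "c \<in> R" and d: "d \<in> R" and cd: "even (\<omega> c d)"
    and nc: "\<exists>b\<in>R. odd (\<omega> c b)" and nd: "\<exists>b\<in>R. odd (\<omega> d b)" and ncd: "\<exists>b\<in>R. odd (\<omega> (c - d) b)"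
  shows "size M \<le> 3"
proof (rule ccontr)
  assume "\<not> size M \<le> 3"
  then have "\<exists>n. size M = Suc (Suc (Suc (Suc n)))" by presburger
  then obtain r1 r2 r3 r4 N where M: "M = add_mset r1 (add_mset r2 (add_mset r3 (add_mset r4 N)))"
    by (auto dest!: size_eq_SucD)
  have MR: "r \<in># M \<Longrightarrow> r \<in> R" for r using minimalD(1)[OF min] .
  have null: "even (\<omega> t b)" if "t \<in> R" "\<And>r. r \<in># M \<Longrightarrow> even (\<omega> t r)" "b \<in> R" for t b
    using minimal_four[OF min M that(1) that(2) that(2) that(2) that(2) that(3)] M skew[of t b] by simp
  have distinct_odd: "odd (\<omega> r r')" if r: "r \<in># M" "r' \<in># M" "r \<noteq> r'" for r r'
  proof -
    obtain N' where N': "M = add_mset r N'" using r(1) by (blast dest: multi_member_split)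
    then have "r' \<in># N'" using r by auto
    then obtain N'' where "N' = add_mset r' N''" by (blast dest: multi_member_split)
    then show ?thesis using minimal_odd[OF min] N' by blast
  qed
  \<comment> \<open>If \<open>s\<close> pairs evenly with a term \<open>r\<close>, then
    \<open>minimal_parity\<close> makes it pair oddly with all other terms, since a second even one
    would force even pairings throughout. So \<open>s - r\<close> pairs evenly with every term, and
    \<open>null\<close> applies to it.\<close>
  have alternative: "(\<exists>r. r \<in># M \<and> (\<forall>b\<in>R. even (\<omega> (s - r) b))) \<or> (\<forall>r. r \<in># M \<longrightarrow> odd (\<omega> s r))"
    if s: "s \<in> R" and ns: "\<exists>b\<in>R. odd (\<omega> s b)" for s
  proof (rule disjCI)
    assume "\<not> (\<forall>r. r \<in># M \<longrightarrow> odd (\<omega> s r))"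
    then obtain r where r: "r \<in># M" "even (\<omega> s r)" by blast
    obtain r' where r': "r' \<in># M" "odd (\<omega> s r')" using ns null[OF s] by blast
    have odd: "odd (\<omega> s u)" if "u \<in># M" "u \<noteq> r" for u
    proof
      assume u: "even (\<omega> s u)"
      obtain N1 where N1: "M = add_mset r N1" using r(1) by (blast dest: multi_member_split)
      then have "u \<in># N1" using that by auto
      then obtain N2 where N2: "N1 = add_mset u N2" by (blast dest: multi_member_split)
      have "r' \<noteq> r" "r' \<noteq> u" using r r' u by auto
      then have "r' \<in># N2" using r'(1) N1 N2 by auto
      then obtain N3 where N3: "N2 = add_mset r' N3" by (blast dest: multi_member_split)
      show False using minimal_parity[OF min _ s r(2) u] N1 N2 N3 r'(2) by blast
    qed
    have "\<forall>b\<in>R. even (\<omega> (s - r) b)"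
    proof
      fix b assume b: "b \<in> R"
      show "even (\<omega> (s - r) b)"
      proof (rule null[OF _ _ b])
        show "s - r \<in> R" using s MR r by (intro R_diff) auto
        fix u assume u: "u \<in># M"
        show "even (\<omega> (s - r) u)"
          using r odd[OF u] distinct_odd[OF r(1) u] by (cases "u = r") (auto simp: bilinear)
      qed
    qed
    then show "\<exists>r. r \<in># M \<and> (\<forall>b\<in>R. even (\<omega> (s - r) b))" using r by blast
  qed
  consider (same) r r' where "r \<in># M" "r' \<in># M" "\<And>b. b \<in> R \<Longrightarrow> even (\<omega> (c - r) b)" "\<And>b. b \<in> R \<Longrightarrow> even (\<omega> (d - r') b)"
    | (left) r where "r \<in># M" "\<And>b. b \<in> R \<Longrightarrow> even (\<omega> (c - r) b)" "odd (\<omega> d r)"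
    | (right) r where "r \<in># M" "\<And>b. b \<in> R \<Longrightarrow> even (\<omega> (d - r) b)" "odd (\<omega> c r)"
    | (none) "\<And>r. r \<in># M \<Longrightarrow> odd (\<omega> c r) \<and> odd (\<omega> d r)"
    using alternative[OF c nc] alternative[OF d nd] by blast
  then show False
  proof cases
    case same
    show False
    proof (cases "r = r'")
      case True
      have "even (\<omega> (c - d) b)" if "b \<in> R" for b
        using same(3)[OF that] same(4)[OF that] True by (simp add: bilinear)
      then show False using ncd by blast
    next
      case False
      have "even (\<omega> (c - r) d)" "even (\<omega> (d - r') r)" using same d MR by blast+
      moreover have "odd (\<omega> r r')" using distinct_odd same False by blast
      ultimately show False using cd skew[of r d] skew[of r r'] by (simp add: bilinear)
    qed
  next
    case left
    then show False using left(2)[OF d] cd skew[of d r] by (simp add: bilinear)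
  next
    case right
    then show False using right(2)[OF c] cd skew[of c r] skew[of d c] by (simp add: bilinear)
  next
    case none
    have "even (\<omega> (c - d) b)" if "b \<in> R" for b
      using none by (intro null[OF R_diff[OF c d cd] _ that]) (simp add: bilinear)
    then show False using ncd by blast
  qed
qed

text \<open>Orthogonal projection onto \<open>W\<close>; the coefficients are integral because
  \<open>x0\<close> and \<open>y0\<close> pair to 1.\<close>

definition proj :: "int^'n \<Rightarrow> int^'n" where "proj x = x - \<omega> x y0 *s x0 - \<omega> x0 x *s y0"

lemma proj_W: "proj x \<in> W"
  using skew[of x0 x] by (simp add: proj_def perp_def bilinear xy yx)

lemma decompose: "x = \<omega> x y0 *s x0 + \<omega> x0 x *s y0 + proj x"
  by (simp add: proj_def vec_eq_iff)

lemma proj_pairing: "w \<in> W \<Longrightarrow> \<omega> w (proj x) = \<omega> w x"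
  by (simp add: proj_def plane)

lemma even_iff:
  assumes w: "w \<in> W" and "\<And>u. u \<in> W \<Longrightarrow> even (\<omega> w u)"
  shows "\<exists>v. w = 2 *s v"
  using assms(2)[OF proj_W] proj_pairing[OF w] by (intro unimodular) simp

end

text \<open>These are the data that a standard permutation without symmetry supplies: isotropic
  vectors spanning \<open>W\<close>, and two of them with even pairing that are nonzero and distinct
  modulo 2.\<close>

locale full_monodromy = plane_monodromy \<omega> q \<Gamma> x0 y0
  for \<omega> :: "int^'n::finite \<Rightarrow> int^'n \<Rightarrow> int" and q and \<Gamma> and x0 y0 +
  fixes B :: "(int^'n) set" and c d
  assumes B_W: "B \<subseteq> W" and qB: "b \<in> B \<Longrightarrow> \<not> q b" and B\<Delta>: "b \<in> B \<Longrightarrow> x0 + y0 + b \<in> \<Delta>"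
    and W_span: "W \<subseteq> int_span B"
    and cB: "c \<in> B" and dB: "d \<in> B" and cd: "even (\<omega> c d)"
    and not_even: "c \<noteq> 2 *s v" "d \<noteq> 2 *s v" "c - d \<noteq> 2 *s v"
begin

lemma B_R: "B \<subseteq> R"
proof
  fix b assume b: "b \<in> B"
  then have "1 *s x0 + 1 *s y0 + b \<in> \<Delta>" using B\<Delta> by simp
  then show "b \<in> R" using R_iff[of 1 1 b] b B_W qB by (auto simp: R_def)
qed

lemma odd_R:
  assumes w: "w \<in> W" and u: "u \<in> W" "odd (\<omega> w u)"
  shows "\<exists>b\<in>R. odd (\<omega> w b)"
proof (rule ccontr)
  assume a: "\<not> (\<exists>b\<in>R. odd (\<omega> w b))"
  have "u \<in> int_span B" using W_span u by blast
  then have "even (\<omega> w u)" 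
    by induction (use a B_R in \<open>auto simp: bilinear\<close>)
  then show False using u by blast
qed

lemma odd_R_nonzero: "w \<in> W \<Longrightarrow> (\<And>v. w \<noteq> 2 *s v) \<Longrightarrow> \<exists>b\<in>R. odd (\<omega> w b)"
  using even_iff odd_R by blast

lemma span_repr:
  assumes "w \<in> int_span B"
  shows "\<exists>M. set_mset M \<subseteq> R \<and> \<Sum>\<^sub># M = w"
  using assms
proof induction
  case zero
  then show ?case by (intro exI[of _ "{#}"]) simp
next
  case (add s b)
  then obtain M where "set_mset M \<subseteq> R" "\<Sum>\<^sub># M = s" by blast
  then show ?case using add B_R by (intro exI[of _ "add_mset b M"]) auto
next
  case (diff s b)
  then obtain M where "set_mset M \<subseteq> R" "\<Sum>\<^sub># M = s" by blast
  then show ?case using diff B_R R_minus by (intro exI[of _ "add_mset (-b) M"]) auto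
qed

text \<open>A shortest expression of \<open>w\<close> has at most three terms by
  \<open>minimal_size\<close>. Two or three isotropic terms with pairwise odd pairings have a sum
  with \<open>q\<close> equal to 1, so an isotropic \<open>w\<close> needs at most one term.\<close>

lemma R_eq: "R = {w \<in> W. \<not> q w}"
proof
  show "{w \<in> W. \<not> q w} \<subseteq> R"
  proof
    fix w assume w: "w \<in> {w \<in> W. \<not> q w}"
    let ?P = "\<lambda>M. set_mset M \<subseteq> R \<and> \<Sum>\<^sub># M = w"
    have "\<exists>M. ?P M" using w W_span by (intro span_repr) blast
    then obtain M where M: "?P M" and least: "\<And>N. ?P N \<Longrightarrow> size M \<le> size N"
      using ex_has_least_nat[of ?P _ size] by metis
    have min: "minimal M" using M least unfolding minimal_def by blast
    have R: "c \<in> R" "d \<in> R" using B_R cB dB by auto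
    then have "size M \<le> 3"
      using R_D[of c] R_D[of d] not_even cd perp_closed
      by (intro minimal_size[OF min, of c d] odd_R_nonzero) auto
    then consider "size M = 0" | "size M = Suc 0" | "size M = Suc (Suc 0)" | "size M = Suc (Suc (Suc 0))" by linarith
    then show "w \<in> R"
    proof cases
      case 1
      then show ?thesis using M R_zero by auto
    next
      case 2
      then obtain r where "M = {#r#}" by (auto dest!: size_eq_SucD)
      then show ?thesis using M by auto
    next
      case 3
      then obtain r r' where r: "M = {#r, r'#}" by (auto dest!: size_eq_SucD)
      then have "odd (\<omega> r r')" using minimal_odd[OF min] by simp
      moreover have "\<not> q r" "\<not> q r'" using M r R_D(2) by auto
      ultimately have "q (r + r')" by (simp add: q_add)
      then show ?thesis using M r w by auto
    next
      case 4
      then obtain r r' r'' where r: "M = {#r, r', r''#}"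
        by (auto dest!: size_eq_SucD)
      then have "odd (\<omega> r r')" "odd (\<omega> r r'')" "odd (\<omega> r' r'')"
        using minimal_odd[OF min, of r r' "{#r''#}"] minimal_odd[OF min, of r r'' "{#r'#}"]
          minimal_odd[OF min, of r' r'' "{#r#}"] by (simp_all add: add_mset_commute)
      moreover have "\<not> q r" "\<not> q r'" "\<not> q r''" using M r R_D(2) by auto
      ultimately have "q (r + (r' + r''))" by (simp add: q_add bilinear)
      then show ?thesis using M r w by auto
    qed
  qed
qed (auto simp: R_def)

end

section \<open>Splitting a lattice into planes modulo 2\<close>

context quadratic_lattice
begin

lemma isometry_fix_perp:
  assumes "isometry f" "\<And>x. x \<in> F \<Longrightarrow> f x = x" "v \<in> perp F"
  shows "f v \<in> perp F"
proof -
  have "\<omega> (f v) x = 0" if "x \<in> F" for x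
    using isometryD(4)[OF assms(1), of v x] assms(2)[OF that] perpD[OF assms(3) that] by simp
  then show ?thesis by (simp add: perp_def)
qed

lemma isometry_fix_id:
  assumes f: "isometry f" and F: "\<And>x. x \<in> F \<Longrightarrow> f x = x" and "perp F = {0}"
  shows "f = id"
proof
  fix v
  have "\<omega> (f v - v) x = 0" if "x \<in> F" for x
    using isometryD(4)[OF f, of v x] F[OF that] by (simp add: diff_left)
  then have "f v - v \<in> perp F" by (simp add: perp_def)
  then show "f v = id v" using assms(3) by simp
qed

text \<open>Each split plane has Arf invariant 0: \<open>q\<close> vanishes on \<open>y\<close> and
  on \<open>x + y\<close>. The basis is normalised by \<open>q x\<close>, rather than by two
  isotropic vectors, so that the transvection along \<open>x\<close> is available.\<close>

inductive hyperbolic :: "(int^'n) set \<Rightarrow> bool" where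
  zero: "hyperbolic {0}"
| plane: "x \<in> M \<Longrightarrow> y \<in> M \<Longrightarrow> \<omega> x y = 1 \<Longrightarrow> q x \<Longrightarrow> \<not> q y \<Longrightarrow> hyperbolic (M \<inter> perp {x, y}) \<Longrightarrow> hyperbolic M"

text \<open>Expresses that \<open>perp F\<close> is unimodular in its own right, without choosing a
  complement.\<close>

definition splits :: "(int^'n) set \<Rightarrow> bool" where
  "splits F \<longleftrightarrow> (\<forall>x. \<exists>x'\<in>perp F. \<forall>v\<in>perp F. \<omega> v x' = \<omega> v x)"

lemma splits_plane:
  assumes F: "splits F" and x: "x \<in> perp F" and y: "y \<in> perp F" and xy: "\<omega> x y = 1"
  shows "splits (F \<union> {x, y})"
  unfolding splits_def
proof
  fix z
  obtain z' where z': "z' \<in> perp F" "\<And>v. v \<in> perp F \<Longrightarrow> \<omega> v z' = \<omega> v z"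
    using F unfolding splits_def by blast
  have yx: "\<omega> y x = -1" using xy skew[of y x] by simp
  \<comment> \<open>The projection of \<open>z'\<close> along the new plane; the subtracted part is
    invisible to vectors orthogonal to \<open>x\<close> and \<open>y\<close>.\<close>
  let ?z = "z' - \<omega> z' y *s x - \<omega> x z' *s y"
  have "?z \<in> perp F" using x y z' by (intro perp_closed)
  moreover have "?z \<in> perp {x, y}" using xy yx skew[of x z'] by (simp add: perp_def bilinear)
  moreover have "\<omega> v ?z = \<omega> v z" if "v \<in> perp (F \<union> {x, y})" for v
  proof -
    have "v \<in> perp F" "\<omega> v x = 0" "\<omega> v y = 0" using that by (auto simp: perp_def)
    then show ?thesis using z'(2) by (simp add: bilinear)
  qed
  ultimately show "\<exists>x'\<in>perp (F \<union> {x, y}). \<forall>v\<in>perp (F \<union> {x, y}). \<omega> v x' = \<omega> v z"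
    unfolding perp_Un by blast
qed

text \<open>A pair with pairing 1 exists by primitivity. Among \<open>x\<close>, \<open>y\<close>
  and \<open>x + y\<close> at least one has \<open>q\<close> equal to 1, and the basis is changed so
  that it comes first.\<close>

lemma hyperbolic_pair:
  assumes F: "splits F" and "perp F \<noteq> {0}"
  obtains x y where "x \<in> perp F" "y \<in> perp F" "\<omega> x y = 1" "q x"
proof -
  obtain v where v: "v \<in> perp F" "v \<noteq> 0" using assms(2) perp_closed(1) by blast
  then obtain n x z where x: "v = n *s x" "n \<noteq> 0" "\<omega> x z = 1" using primitive_multiple by metis
  have xF: "x \<in> perp F" using v(1) x(2) unfolding x(1) perp_def by (simp add: scale_left)
  obtain y where y: "y \<in> perp F" "\<omega> x y = 1" using F xF x(3) unfolding splits_def by metis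
  have yx: "\<omega> y x = -1" using y(2) skew[of y x] by simp
  consider "q x" | "\<not> q x" "q y" | "\<not> q x" "\<not> q y" by blast
  then show ?thesis
  proof cases
    case 1
    then show ?thesis using that xF y by blast
  next
    case 2
    then show ?thesis using that[of y "- x"] xF y yx by (simp add: minus_right perp_closed)
  next
    case 3
    then have "q (x + y)" using y by (simp add: q_add)
    then show ?thesis using that[of "x + y" y] xF y by (simp add: add_left perp_closed)
  qed
qed

text \<open>Planes are split off one by one. Whenever two anisotropic ones occur they are exchanged
  for two hyperbolic ones, so at most one is left. The induction counts parity patterns of vectors
  in \<open>perp F\<close>.\<close>

lemma perp_decomposition:
  assumes "splits F"
  shows "hyperbolic (perp F) \<or>
    (\<exists>x y. x \<in> perp F \<and> y \<in> perp F \<and> \<omega> x y = 1 \<and> q x \<and> q y \<and> hyperbolic (perp (F \<union> {x, y})))"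
  using assms
proof (induction "card ((\<lambda>v. {i. odd (v $ i)}) ` perp F)" arbitrary: F rule: less_induct)
  case less
  let ?red = "\<lambda>v::int^'n. {i. odd (v $ i)}"
  show ?case
  proof (cases "perp F = {0}")
    case True
    then show ?thesis using zero by simp
  next
    case False
    then obtain x y where x: "x \<in> perp F" and y: "y \<in> perp F" and xy: "\<omega> x y = 1" and qx: "q x"
      using hyperbolic_pair less.prems by metis
    let ?G = "F \<union> {x, y}"
    have yx: "\<omega> y x = -1" using xy skew[of y x] by simp
    \<comment> \<open>The pattern of \<open>x\<close> is lost in passing to the smaller complement:
      a vector there congruent to \<open>x\<close> modulo 2 would make the pairing 1 with
      \<open>y\<close> even.\<close>
    have "?red x \<notin> ?red ` perp ?G"
    proof
      assume "?red x \<in> ?red ` perp ?G"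
      then obtain v where v: "v \<in> perp ?G" and "?red x = ?red v" by blast
      then have "2 dvd x $ i - v $ i" for i by (auto simp: set_eq_iff)
      then have "x - v = 2 *s (\<chi> i. (x $ i - v $ i) div 2)" by (simp add: vec_eq_iff)
      then have "\<omega> (x - v) y = 2 * \<omega> (\<chi> i. (x $ i - v $ i) div 2) y" by (simp only: scale_left)
      moreover have "\<omega> (x - v) y = 1" using v by (simp add: diff_left xy perpD)
      ultimately show False by presburger
    qed
    then have "?red ` perp ?G \<subset> ?red ` perp F"
      using image_mono[of "perp ?G" "perp F" ?red] x unfolding perp_Un by blast
    then have "card (?red ` perp ?G) < card (?red ` perp F)"
      by (intro psubset_card_mono) auto
    note IH = less.hyps[OF this splits_plane[OF less.prems x y xy]]
    show ?thesis
    proof (cases "q y")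
      case False
      from IH show ?thesis
      proof (elim disjE exE conjE)
        assume "hyperbolic (perp ?G)"
        then show ?thesis using plane[OF x y xy qx False] unfolding perp_Un by blast
      next
        fix x' y'
        assume *: "x' \<in> perp ?G" "y' \<in> perp ?G" "\<omega> x' y' = 1" "q x'" "q y'" "hyperbolic (perp (?G \<union> {x', y'}))"
        have "perp (?G \<union> {x', y'}) = perp (F \<union> {x', y'}) \<inter> perp {x, y}" by (auto simp: perp_def)
        moreover have "x \<in> perp (F \<union> {x', y'})" "y \<in> perp (F \<union> {x', y'})"
          using x y *(1,2) by (auto simp: perp_def skew[of x] skew[of y])
        ultimately have "hyperbolic (perp (F \<union> {x', y'}))" using plane[OF _ _ xy qx False] *(6) by simp
        moreover have "x' \<in> perp F" "y' \<in> perp F" using * by (auto simp: perp_def)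
        ultimately show ?thesis using *(3-5) by blast
      qed
    next
      case True
      from IH show ?thesis
      proof (elim disjE exE conjE)
        assume "hyperbolic (perp ?G)"
        then show ?thesis using x y xy qx True by blast
      next
        fix x' y'
        assume *: "x' \<in> perp ?G" "y' \<in> perp ?G" "\<omega> x' y' = 1" "q x'" "q y'" "hyperbolic (perp (?G \<union> {x', y'}))"
        have o: "\<omega> x' x = 0" "\<omega> x' y = 0" "\<omega> y' x = 0" "\<omega> y' y = 0" "\<omega> x x' = 0" "\<omega> y x' = 0"
          "\<omega> x y' = 0" "\<omega> y y' = 0" "\<omega> y' x' = -1"
          using *(1-3) skew[of y' x'] by (auto dest: perpD perpD')
        have F': "x' \<in> perp F" "y' \<in> perp F" using *(1,2) unfolding perp_Un by blast+
        \<comment> \<open>Two anisotropic planes are isometric modulo 2 to two hyperbolic ones.\<close>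
        have "perp (?G \<union> {x', y'}) = perp F \<inter> perp {x, y + x'} \<inter> perp {x', y' + x}"
          by (auto simp: perp_def bilinear)
        with *(6) have h: "hyperbolic (perp F \<inter> perp {x, y + x'} \<inter> perp {x', y' + x})" by (simp only:)
        have nq: "\<not> q (y' + x)" "\<not> q (y + x')" using * qx True by (simp_all add: q_add o)
        have x'M: "x' \<in> perp F \<inter> perp {x, y + x'}" and y'M: "y' + x \<in> perp F \<inter> perp {x, y + x'}"
          using F' x by (auto simp: perp_closed) (auto simp: perp_def bilinear o xy)
        have "hyperbolic (perp F \<inter> perp {x, y + x'})"
          by (rule plane[OF x'M y'M _ *(4) nq(1) h]) (simp add: bilinear o *(3))
        moreover have "y + x' \<in> perp F" "\<omega> x (y + x') = 1"
          using y F' by (auto simp: bilinear o xy perp_closed)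
        ultimately have "hyperbolic (perp F)" using plane[OF x _ _ qx nq(2)] by blast
        then show ?thesis by blast
      qed
    qed
  qed
qed

end

section \<open>Transitivity on vectors and generation of the isometry group\<close>

context full_monodromy
begin

lemma W_\<Delta>: "coprime i j \<Longrightarrow> w \<in> W \<Longrightarrow> \<not> q w \<Longrightarrow> i *s x0 + j *s y0 + w \<in> \<Delta>"
  using R_iff[of i j w] R_eq by (auto simp: R_def)

lemma plane_perp: "F \<subseteq> W \<Longrightarrow> x0 \<in> perp F" "F \<subseteq> W \<Longrightarrow> y0 \<in> perp F"
  using perp_sym[of F "{x0, y0}"] by auto

lemma proj_perp: "F \<subseteq> W \<Longrightarrow> v \<in> perp F \<Longrightarrow> proj v \<in> W \<inter> perp F"
  using proj_W plane_perp by (auto simp: proj_def intro!: perp_closed)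

lemma euclid_perp: "F \<subseteq> W \<Longrightarrow> \<exists>f\<in>stab F. \<forall>w\<in>W. f (i *s x0 + j *s y0 + w) = gcd i j *s x0 + w"
proof -
  assume "F \<subseteq> W"
  moreover obtain f where f: "f \<in> stab W" "f (i *s x0 + j *s y0) = gcd i j *s x0" using euclid by blast
  moreover have "f (i *s x0 + j *s y0 + w) = gcd i j *s x0 + w" if "w \<in> W" for w
    using stab_W_plane[OF f(1) that, of "i *s x0 + j *s y0"] f(2) by simp
  ultimately show ?thesis using stab_mono by blast
qed

text \<open>The transvection along \<open>y0 + 2 *s s\<close> creates the
  \<open>y0\<close>-coefficient \<open>k + 2 * e\<close>. It is coprime to \<open>k\<close>, since
  the pairing 1 makes \<open>e\<close> coprime to \<open>k\<close> and \<open>k\<close> is odd, so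
  Euclid's algorithm reduces the plane part to \<open>x0\<close>.\<close>

lemma absorb_odd:
  assumes F: "F \<subseteq> W" and w: "w \<in> W \<inter> perp F" and t: "t \<in> perp F" and one: "\<omega> (k *s x0 + w) t = 1"
    and k: "odd k"
  shows "\<exists>f\<in>stab F. \<exists>w'\<in>W \<inter> perp F. f (k *s x0 + w) = x0 + w'"
proof -
  define s where "s = proj t"
  have s: "s \<in> W \<inter> perp F" unfolding s_def by (rule proj_perp[OF F t])
  define e where "e = \<omega> w s"
  have "k * \<omega> x0 t + e = 1" using one w by (simp add: bilinear e_def s_def proj_pairing)
  then have "coprime k e" by (metis coprimeI dvd_add dvd_mult2)
  moreover have "coprime k 2" using k by simp
  ultimately have "coprime k (2 * e)" by simp
  then have "coprime k (k + 2 * e)" by (simp add: coprime_iff_gcd_eq_1)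
  define u where "u = y0 + 2 *s s"
  have "0 *s x0 + 1 *s y0 + 2 *s s \<in> \<Delta>" using s q_even by (intro W_\<Delta>) (auto simp: perp_closed)
  then have "u \<in> \<Delta>" by (simp add: u_def)
  moreover have "u \<in> perp F" using s plane_perp[OF F] by (auto simp: u_def perp_closed)
  ultimately have T: "transv u \<in> stab F" by (rule transv_stab)
  let ?c = "k + 2 * e" and ?w = "w + (2 * (k + 2 * e)) *s s"
  have "\<omega> (k *s x0 + w) u = ?c" using w s by (simp add: u_def plane e_def)
  then have Tv: "transv u (k *s x0 + w) = k *s x0 + ?c *s y0 + ?w"
    by (simp add: transv_def u_def vec_eq_iff algebra_simps)
  obtain f where f: "f \<in> stab F" "\<And>w. w \<in> W \<Longrightarrow> f (k *s x0 + ?c *s y0 + w) = gcd k ?c *s x0 + w"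
    using euclid_perp[OF F] by blast
  have w': "?w \<in> W \<inter> perp F" using w s by (auto simp: perp_closed)
  then have "(f \<circ> transv u) (k *s x0 + w) = x0 + ?w"
    unfolding comp_apply Tv using f(2)[of ?w] \<open>coprime k ?c\<close>[unfolded coprime_iff_gcd_eq_1] by simp
  then show ?thesis using w' stab_comp[OF f(1) T] by blast
qed

text \<open>Euclid's algorithm first reduces the plane part to \<open>k *s x0\<close>. If
  \<open>k\<close> is even, a transvection along \<open>y0 + s\<close> makes the coefficient gcd
  odd, and \<open>absorb_odd\<close> finishes. The supply of isotropic \<open>s\<close> is a
  hypothesis because it comes from \<open>R\<close> when \<open>F\<close> is empty and from a
  hyperbolic pair in general.\<close>

lemma absorb:
  assumes F: "F \<subseteq> W"
    and isotropic: "\<And>w t. w \<in> W \<inter> perp F \<Longrightarrow> t \<in> W \<inter> perp F \<Longrightarrow> odd (\<omega> w t) \<Longrightarrow>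
      \<exists>s\<in>W \<inter> perp F. \<not> q s \<and> odd (\<omega> w s)"
    and v: "v \<in> perp F" and t: "t \<in> perp F" and one: "\<omega> v t = 1" and qv: "q v"
  shows "\<exists>f\<in>stab F. \<exists>w\<in>W \<inter> perp F. \<not> q w \<and> f v = x0 + w"
proof -
  define k where "k = gcd (\<omega> v y0) (\<omega> x0 v)"
  define w where "w = proj v"
  have w: "w \<in> W \<inter> perp F" unfolding w_def by (rule proj_perp[OF F v])
  obtain f where f: "f \<in> stab F" "f v = k *s x0 + w"
    using euclid_perp[OF F, of "\<omega> v y0" "\<omega> x0 v"] w decompose[of v] by (metis IntD1 k_def w_def)
  note iso_f = isometryD[OF stab_iso[OF f(1)]]
  have ft: "f t \<in> perp F" using stab_perp[OF f(1) t] .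
  have one': "\<omega> (k *s x0 + w) (f t) = 1" using iso_f(4)[of v t] one f(2) by simp
  have "\<exists>g\<in>stab F. \<exists>w'\<in>W \<inter> perp F. g (k *s x0 + w) = x0 + w'"
  proof (cases "odd k")
    case True
    then show ?thesis by (rule absorb_odd[OF F w ft one'])
  next
    case False
    \<comment> \<open>With \<open>k\<close> even, the value 1 must come from an odd pairing of
      \<open>w\<close> inside \<open>W\<close>, which is what the supply of \<open>s\<close>
      requires.\<close>
    have "k * \<omega> x0 (f t) + \<omega> w (proj (f t)) = 1"
      using one' w by (simp add: bilinear proj_pairing)
    then have "odd (\<omega> w (proj (f t)))" using False
      by (metis even_add even_mult_iff odd_one)
    then obtain s where s: "s \<in> W \<inter> perp F" "\<not> q s" "odd (\<omega> w s)"
      using isotropic[OF w proj_perp[OF F ft]] by blast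
    define u where "u = y0 + s"
    have "0 *s x0 + 1 *s y0 + s \<in> \<Delta>" using s by (intro W_\<Delta>) auto
    then have "u \<in> \<Delta>" by (simp add: u_def)
    moreover have "u \<in> perp F" using s plane_perp[OF F] by (auto simp: u_def perp_closed)
    ultimately have T: "transv u \<in> stab F" by (rule transv_stab)
    let ?c = "k + \<omega> w s"
    let ?w = "w + ?c *s s"
    have "\<omega> (k *s x0 + w) u = ?c" using w s by (simp add: u_def plane)
    then have Tv: "transv u (k *s x0 + w) = k *s x0 + ?c *s y0 + ?w"
      by (simp add: transv_def u_def vec_eq_iff algebra_simps)
    have w': "?w \<in> W \<inter> perp F" using w s by (auto simp: perp_closed)
    obtain g where g: "g \<in> stab F" "g (k *s x0 + ?c *s y0 + ?w) = gcd k ?c *s x0 + ?w"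
      using euclid_perp[OF F] w' by blast
    have gT: "g \<circ> transv u \<in> stab F" by (rule stab_comp[OF g(1) T])
    have "(g \<circ> transv u) (k *s x0 + w) = gcd k ?c *s x0 + ?w" using g Tv by simp
    moreover from this have "\<omega> (gcd k ?c *s x0 + ?w) ((g \<circ> transv u) (f t)) = 1"
      using isometryD(4)[OF stab_iso[OF gT], of "k *s x0 + w" "f t"] one' by simp
    moreover have "odd ?c" using False s by simp
    then have "odd (gcd k ?c)" by (metis gcd_dvd2 dvd_trans)
    ultimately obtain h w'' where "h \<in> stab F" "w'' \<in> W \<inter> perp F"
      "h ((g \<circ> transv u) (k *s x0 + w)) = x0 + w''"
      using absorb_odd[OF F w' stab_perp[OF gT ft]] by metis
    then show ?thesis using stab_comp[OF _ gT] by (metis comp_apply)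
  qed
  then obtain g w' where g: "g \<in> stab F" "w' \<in> W \<inter> perp F" "g (f v) = x0 + w'" using f(2) by auto
  have gf: "g \<circ> f \<in> stab F" by (rule stab_comp[OF g(1) f(1)])
  have "q (x0 + w')" using isometryD(5)[OF stab_iso[OF gf], of v] g(3) qv by simp
  then have "\<not> q w'" using g(2) qx by (simp add: q_add W_D)
  then show ?thesis using g gf by (metis comp_apply)
qed

text \<open>The group carries \<open>v\<close> to some \<open>x0 + w\<close> with \<open>w\<close>
  isotropic, and \<open>R_eq\<close> puts all such vectors into \<open>\<Delta>\<close>.\<close>

lemma primitive_\<Delta>:
  assumes "q v" "\<omega> v t = 1"
  shows "v \<in> \<Delta>"
proof -
  have [simp]: "perp {} = UNIV" by (simp add: perp_def)
  have "\<exists>s\<in>W. \<not> q s \<and> odd (\<omega> w s)" if "w \<in> W" "t \<in> W" "odd (\<omega> w t)" for w t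
    using odd_R[OF that] R_D by blast
  then have "\<exists>f\<in>stab {}. \<exists>w\<in>W \<inter> perp {}. \<not> q w \<and> f v = x0 + w"
    using assms by (intro absorb[of "{}" v t]) auto
  then obtain f w where f: "f \<in> \<Gamma>" "w \<in> W" "\<not> q w" "f v = x0 + w" by (auto simp: stab_def)
  then have "1 *s x0 + 0 *s y0 + w \<in> \<Delta>" by (intro W_\<Delta>) auto
  then show ?thesis using \<Delta>_image_iff[OF f(1), of v] f(4) by simp
qed

text \<open>The difference \<open>v - u\<close> is primitive with \<open>q\<close> equal to 1, so
  its transvection is available; this or its inverse carries \<open>v\<close> to
  \<open>u\<close>.\<close>

lemma move:
  assumes "v - u \<in> perp F" "q v \<longleftrightarrow> q u" "\<bar>\<omega> v u\<bar> = 1"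
  shows "\<exists>f\<in>stab F. f v = u"
proof -
  have "\<omega> v u = 1 \<or> \<omega> v u = -1" using assms(3) by linarith
  then have "q (v - u)" "\<omega> (v - u) (\<omega> v u *s v) = 1"
    using assms(2) skew[of u v] by (auto simp: q_diff bilinear)
  then have "v - u \<in> \<Delta>" by (rule primitive_\<Delta>)
  then have T: "transv (v - u) \<in> stab F" using assms(1) by (rule transv_stab)
  from \<open>\<omega> v u = 1 \<or> \<omega> v u = -1\<close> show ?thesis
  proof
    assume "\<omega> v u = 1"
    then have "transv (v - u) v = u" by (simp add: transv_def bilinear vec_eq_iff)
    then show ?thesis using T by blast
  next
    assume "\<omega> v u = -1"
    then have "inv (transv (v - u)) v = u" by (simp add: inv_transv bilinear vec_eq_iff)
    then show ?thesis using stab_inv[OF T] by blast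
  qed
qed

text \<open>After \<open>absorb\<close> the vector is \<open>x0 + w\<close>. Two applications of
  \<open>move\<close> then lead through an intermediate vector to \<open>x\<close>.\<close>

lemma transitive:
  assumes F: "F \<subseteq> W" and x: "x \<in> W \<inter> perp F" and y: "y \<in> W \<inter> perp F" and xy': "\<omega> x y = 1"
    and q: "q x" "\<not> q y"
    and v: "v \<in> perp F" "t \<in> perp F" "\<omega> v t = 1" "q v"
  shows "\<exists>f\<in>stab F. f v = x"
proof -
  have "\<exists>s\<in>W \<inter> perp F. \<not> q s \<and> odd (\<omega> w s)"
    if w: "w \<in> W \<inter> perp F" and t: "t \<in> W \<inter> perp F" and odd: "odd (\<omega> w t)" for w t
  proof -
    \<comment> \<open>Both \<open>y\<close> and \<open>x + y\<close> are isotropic and serve when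
      \<open>w\<close> pairs oddly with one of them. Otherwise \<open>t\<close>,
      \<open>t + x\<close>, \<open>t + y\<close> and \<open>t + (x + y)\<close> all pair oddly with
      \<open>w\<close>, and one of these four is isotropic.\<close>
    have "\<not> q (x + y)" using q xy' by (simp add: q_add)
    moreover have "\<not> q (t + x) \<or> \<not> q (t + y) \<or> \<not> q (t + (x + y))" if "q t"
      using q xy' that by (auto simp: q_add bilinear)
    moreover have "odd (\<omega> w (x + y)) \<or> odd (\<omega> w y) \<or> even (\<omega> w x) \<and> even (\<omega> w y)"
      by (simp add: add_right)
    moreover have "odd (\<omega> w (t + x)) \<and> odd (\<omega> w (t + y)) \<and> odd (\<omega> w (t + (x + y)))"
      if "even (\<omega> w x)" "even (\<omega> w y)" using that odd by (simp add: add_right)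
    moreover have "{x + y, y, t, t + x, t + y, t + (x + y)} \<subseteq> W \<inter> perp F"
      using x y t by (auto simp: perp_closed)
    ultimately show ?thesis using q odd by (metis insert_subset)
  qed
  then obtain f w where f: "f \<in> stab F" "w \<in> W \<inter> perp F" "\<not> q w" "f v = x0 + w"
    using absorb[OF F _ v] by blast
  \<comment> \<open>The \<open>y0\<close>-coefficient makes the pairing with \<open>x0 + w\<close>
    equal to 1, while the summand \<open>y\<close> gives pairing -1 with \<open>x\<close>.\<close>
  define u where "u = 1 *s x0 + (1 - \<omega> w y) *s y0 + y"
  have qu: "q u" and qxw: "q (x0 + w)"
    using q qx qy f(2,3) y by (auto simp: u_def q_simps plane)
  have wu: "\<omega> (x0 + w) u = 1" and ux: "\<omega> u x = -1"
    using f(2) x y xy' skew[of y x] by (auto simp: u_def plane)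
  have "u \<in> perp F" "x0 + w \<in> perp F" "x \<in> perp F"
    using plane_perp[OF F] f(2) x y by (auto simp: u_def intro!: perp_closed)
  then obtain g h where g: "g \<in> stab F" "g (x0 + w) = u" and h: "h \<in> stab F" "h u = x"
    using move[of "x0 + w" u F] move[of u x F] qu qxw q wu ux perp_closed(3) by auto
  have "h \<circ> (g \<circ> f) \<in> stab F" by (intro stab_comp f g h)
  moreover have "(h \<circ> (g \<circ> f)) v = x" using f g h by simp
  ultimately show ?thesis by blast
qed

lemma shear: 
  assumes "x \<in> \<Delta>" "\<omega> x y = 1" "x \<in> perp F"
  shows "\<exists>f\<in>stab (insert x F). f (y + n *s x) = y"
proof -
  have yx: "\<omega> y x = -1" using skew[of y x] assms by simp
  have T: "transv x \<in> stab (insert x F)" using assms by (intro transv_stab) (auto simp: perp_def)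
  have t: "transv x (y + n *s x) = y + (n - 1) *s x" "inv (transv x) (y + n *s x) = y + (n + 1) *s x" for n
    by (simp_all add: transv_def inv_transv bilinear yx vec_eq_iff algebra_simps)
  show ?thesis
  proof (induction n rule: int_induct[where k = 0])
    case base
    then show ?case by (intro bexI[of _ id]) (auto simp: stab_id)
  next
    case (step1 i)
    then obtain f where "f \<in> stab (insert x F)" "f (y + i *s x) = y" by blast
    then have "(f \<circ> transv x) (y + (i + 1) *s x) = y" using t(1)[of "i + 1"] by simp
    then show ?case using stab_comp[OF \<open>f \<in> _\<close> T] by blast
  next
    case (step2 i)
    then obtain f where "f \<in> stab (insert x F)" "f (y + i *s x) = y" by blast
    then have "(f \<circ> inv (transv x)) (y + (i - 1) *s x) = y" using t(2)[of "i - 1"] by simp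
    then show ?case using stab_comp[OF \<open>f \<in> _\<close> stab_inv[OF T]] by blast
  qed
qed

text \<open>Once \<open>x\<close> is restored, the image \<open>y'\<close> of \<open>y\<close> still
  pairs with \<open>x\<close> correctly. It is moved to \<open>y + m *s x\<close> by a transvection
  fixing \<open>x\<close> and \<open>F\<close>, and \<open>shear\<close> removes the multiple of
  \<open>x\<close>.\<close>

lemma strip_plane:
  assumes x: "x \<in> perp F" and y: "y \<in> perp F" and xy': "\<omega> x y = 1" and q: "q x"
    and S: "isometry S" "\<And>z. z \<in> F \<Longrightarrow> S z = z"
    and onto: "\<exists>f\<in>stab F. f (S x) = x"
  shows "\<exists>f\<in>stab F. \<forall>z\<in>F \<union> {x, y}. f (S z) = z"
proof -
  obtain f where f: "f \<in> stab F" "f (S x) = x" using onto by blast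
  define y' where "y' = f (S y)"
  have iso': "isometry (f \<circ> S)" using isometry_comp stab_iso f S by blast
  have fix': "(f \<circ> S) z = z" if "z \<in> F" for z using that f S by (simp add: stab_def)
  have y': "y' \<in> perp F" using isometry_fix_perp[OF iso' fix' y] by (simp add: y'_def)
  have xy'': "\<omega> x y' = 1" using isometryD(4)[OF iso', of x y] xy' f by (simp add: y'_def)
  have qy': "q y' \<longleftrightarrow> q y" using isometryD(5)[OF iso', of y] by (simp add: y'_def)
  \<comment> \<open>This choice gives \<open>y'\<close> and \<open>y + m *s x\<close> pairing 1, as
    \<open>move\<close> demands.\<close>
  define m where "m = \<omega> y' y - 1"
  define u where "u = y + m *s x"
  have yx: "\<omega> y x = -1" "\<omega> y' x = -1" using skew[of _ x] xy' xy'' by auto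
  have "y' - u \<in> perp (insert x F)"
    using x y y' yx by (auto simp: u_def perp_def bilinear)
  moreover have "q y' \<longleftrightarrow> q u" using qy' q by (auto simp: u_def q_simps bilinear yx)
  moreover have "\<omega> y' u = 1" by (simp add: u_def bilinear yx m_def)
  ultimately obtain g where g: "g \<in> stab (insert x F)" "g y' = u" using move[of y' u] by auto
  have "x \<in> \<Delta>" using primitive_\<Delta> q xy' .
  then obtain h where h: "h \<in> stab (insert x F)" "h u = y"
    using shear[OF _ xy' x] unfolding u_def by blast
  let ?f = "h \<circ> (g \<circ> f)"
  have "?f \<in> stab F" using g h f stab_mono[of F "insert x F"] by (intro stab_comp) auto
  moreover have "?f (S z) = z" if "z \<in> F \<union> {x, y}" for z
    using that f g h S y'_def by (auto simp: stab_def)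
  ultimately show ?thesis by blast
qed

lemma \<Gamma>_cancel:
  assumes "f \<in> \<Gamma>" "f \<circ> S \<in> \<Gamma>"
  shows "S \<in> \<Gamma>"
proof -
  have "inv f \<circ> (f \<circ> S) = S" using isometryD(7)[OF iso[OF assms(1)]] by auto
  then show ?thesis using comp_mem[OF inv_mem[OF assms(1)] assms(2)] by simp
qed

text \<open>\<open>F\<close> collects the vectors already fixed, all inside \<open>W\<close>, so the
  plane of \<open>x0\<close> and \<open>y0\<close> stays free for \<open>transitive\<close> in every
  step and is itself treated last.\<close>

lemma hyperbolic_generated:
  assumes "hyperbolic M"
  shows "F \<subseteq> W \<Longrightarrow> perp F \<inter> W = M \<Longrightarrow> isometry S \<Longrightarrow> (\<And>z. z \<in> F \<Longrightarrow> S z = z) \<Longrightarrow> S \<in> \<Gamma>"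
  using assms
proof (induction arbitrary: F S rule: hyperbolic.induct)
  case zero
  note F = zero.prems(1) and S = zero.prems(3,4)
  note xF = plane_perp[OF F]
  have S0: "S x0 \<in> perp F" using isometry_fix_perp[OF S xF(1)] .
  define i j where "i = \<omega> (S x0) y0" and "j = \<omega> x0 (S x0)"
  \<comment> \<open>Nothing of \<open>W\<close> is left orthogonal to \<open>F\<close>, so
    \<open>S\<close> sends \<open>x0\<close> to a plane vector, primitive because it pairs to 1 with
    \<open>S y0\<close>.\<close>
  have "proj (S x0) = 0" using proj_perp[OF F S0] zero.prems(2) by auto
  then have Sx: "S x0 = i *s x0 + j *s y0" using decompose[of "S x0"] by (simp add: i_def j_def)
  have "i * \<omega> x0 (S y0) + j * \<omega> y0 (S y0) = 1"
    using isometryD(4)[OF S(1), of x0 y0] xy by (simp add: Sx bilinear)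
  then have "coprime i j" by (metis coprimeI dvd_add dvd_mult2)
  then have "\<exists>f\<in>stab F. f (S x0) = x0" using euclid_perp[OF F, of i j] perp_closed(1) Sx by force
  then obtain f where f: "f \<in> stab F" "\<And>z. z \<in> F \<union> {x0, y0} \<Longrightarrow> f (S z) = z"
    using strip_plane[OF xF xy qx S] by blast
  have "perp (F \<union> {x0, y0}) = {0}" using zero.prems(2) unfolding perp_Un .
  then have "f \<circ> S = id"
    using f isometry_comp[OF stab_iso[OF f(1)] S(1)]
    by (intro isometry_fix_id[of _ "F \<union> {x0, y0}"]) auto
  then show ?case using \<Gamma>_cancel[of f S] f(1) id_mem by (simp add: stab_def)
next
  case (plane x M y)
  note F = plane.prems(1) and S = plane.prems(3,4)
  have x: "x \<in> W \<inter> perp F" and y: "y \<in> W \<inter> perp F" using plane.hyps plane.prems(2) by auto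
  have "S x \<in> perp F" "S y \<in> perp F" using isometry_fix_perp[OF S] x y by auto
  moreover have "\<omega> (S x) (S y) = 1" "q (S x)" using isometryD[OF S(1)] plane.hyps by auto
  ultimately have "\<exists>f\<in>stab F. f (S x) = x"
    using transitive[OF F x y] plane.hyps by blast
  then obtain f where f: "f \<in> stab F" "\<And>z. z \<in> F \<union> {x, y} \<Longrightarrow> f (S z) = z"
    using strip_plane[of x F y S] x y plane.hyps S by blast
  have "f \<circ> S \<in> \<Gamma>"
  proof (rule plane.IH)
    show "F \<union> {x, y} \<subseteq> W" using F x y by auto
    show "perp (F \<union> {x, y}) \<inter> W = M \<inter> perp {x, y}" using plane.prems(2) unfolding perp_Un by blast
    show "isometry (f \<circ> S)" using isometry_comp stab_iso f S by blast
  qed (use f in auto)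
  then show ?case using \<Gamma>_cancel[of f S] f(1) by (simp add: stab_def)
qed

text \<open>If \<open>W\<close> contains an anisotropic plane, that plane is stripped first with the
  help of a hyperbolic pair elsewhere in \<open>W\<close>; the remainder falls under
  \<open>hyperbolic_generated\<close>.\<close>

theorem isometry_mem:
  assumes S: "isometry S"
  shows "S \<in> \<Gamma>"
proof -
  have "splits {x0, y0}" unfolding splits_def using proj_W proj_pairing by blast
  then consider "hyperbolic W"
    | x y where "x \<in> W" "y \<in> W" "\<omega> x y = 1" "q x" "q y" "hyperbolic (perp ({x0, y0} \<union> {x, y}))"
    using perp_decomposition by blast
  then show ?thesis
  proof cases
    case 1
    then show ?thesis using S by (intro hyperbolic_generated[of W "{}"]) (auto simp: perp_def)
  next
    case (2 x y)
    let ?N = "perp ({x0, y0} \<union> {x, y})"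
    have yx': "\<omega> y x = -1" using skew[of y x] 2 by simp
    from 2(6) show ?thesis
    proof cases
      case zero
      \<comment> \<open>Here \<open>W\<close> is a single plane on which \<open>q\<close> is
        anisotropic, so the isotropic vector \<open>c\<close> would have even coordinates.\<close>
      let ?i = "\<omega> c y" and ?j = "\<omega> x c"
      have "c \<in> W" using cB B_W by auto
      then have "c - ?i *s x - ?j *s y \<in> W" using 2 perp_closed by simp
      moreover have "c - ?i *s x - ?j *s y \<in> perp {x, y}"
        using 2(3) yx' skew[of x c] by (simp add: perp_def bilinear)
      ultimately have "c - ?i *s x - ?j *s y \<in> ?N" by (simp only: perp_Un Int_iff)
      then have "c - ?i *s x - ?j *s y = 0" unfolding zero by simp
      then have c: "c = ?i *s x + ?j *s y" by (simp add: algebra_simps)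
      have "\<not> q (?i *s x + ?j *s y)" using qB[OF cB] c by simp
      then have "even ?i" "even ?j" using 2 by (auto simp: q_simps bilinear)
      then have "c = 2 *s ((?i div 2) *s x + (?j div 2) *s y)"
        using c by (simp add: vector_add_ldistrib)
      then show ?thesis using not_even(1) by blast
    next
      case (plane x2 y2)
      \<comment> \<open>Both \<open>x\<close> and \<open>S x\<close> can be carried to
        \<open>x2\<close>, hence \<open>S x\<close> to \<open>x\<close>, although \<open>x\<close>
        itself belongs to an anisotropic plane.\<close>
      have W2: "x2 \<in> W" "y2 \<in> W" using plane unfolding perp_Un by auto
      have "\<exists>f\<in>stab {}. f v = x2" if "\<omega> v t = 1" "q v" for v t
        using that W2 plane by (intro transitive[of "{}" x2 y2 v t]) (auto simp: perp_def[of "{}"])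
      moreover have "\<omega> (S x) (S y) = 1" "q (S x)" using isometryD[OF S] 2 by auto
      ultimately obtain f g where f: "f \<in> \<Gamma>" "f x = x2" and g: "g \<in> \<Gamma>" "g (S x) = x2"
        using 2 unfolding stab_def by blast
      have "(inv f \<circ> g) (S x) = x" using f g isometryD(7)[OF iso[OF f(1)], of x] by simp
      moreover have "inv f \<circ> g \<in> stab {}" using f g comp_mem inv_mem by (simp add: stab_def)
      ultimately have "\<exists>h\<in>stab {}. h (S x) = x" by blast
      moreover have "x \<in> perp {}" "y \<in> perp {}" by (auto simp: perp_def)
      ultimately obtain h where h: "h \<in> stab {}" "\<And>z. z \<in> {} \<union> {x, y} \<Longrightarrow> h (S z) = z"
        using strip_plane[of x "{}" y S] 2 S by blast
      have "perp {x, y} \<inter> W = ?N" unfolding perp_Un by blast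
      then have "h \<circ> S \<in> \<Gamma>"
        using 2 h isometry_comp[OF stab_iso[OF h(1)] S]
        by (intro hyperbolic_generated[OF 2(6), of "{x, y}"]) auto
      then show ?thesis using \<Gamma>_cancel[of h S] h(1) by (simp add: stab_def)
    qed
  qed
qed

end

section \<open>Rauzy induction\<close>

lemma is_permD:
  fixes p :: "('a::finite) iperm"
  assumes "is_perm p"
  shows "inj (ptop p)" "inj (pbot p)" "1 \<le> ptop p a" "ptop p a \<le> CARD('a)" "1 \<le> pbot p a" "pbot p a \<le> CARD('a)"
  using assms unfolding is_perm_def bij_betw_def by (auto simp: set_eq_iff)

lemma atop_ptop: "is_perm p \<Longrightarrow> atop p (ptop p a) = a"
  and abot_pbot: "is_perm p \<Longrightarrow> abot p (pbot p a) = a"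
  unfolding atop_def abot_def using is_permD(1,2)[of p] by (auto intro!: the_equality dest: injD)

lemma ptop_atop:
  fixes p :: "('a::finite) iperm"
  assumes "is_perm p" "1 \<le> j" "j \<le> CARD('a)"
  shows "ptop p (atop p j) = j" "pbot p (abot p j) = j"
proof -
  have "j \<in> ptop p ` UNIV" "j \<in> pbot p ` UNIV" using assms unfolding is_perm_def bij_betw_def by auto
  then show "ptop p (atop p j) = j" "pbot p (abot p j) = j"
    using atop_ptop abot_pbot assms(1) by (metis imageE)+
qed

lemma is_perm_inject:
  assumes "is_perm p"
  shows "ptop p a = ptop p b \<longleftrightarrow> a = b" "pbot p a = pbot p b \<longleftrightarrow> a = b"
  using is_permD(1,2)[OF assms] by (auto dest: injD)

lemma atop_eq_iff:
  fixes p :: "('a::finite) iperm"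
  assumes "is_perm p" "1 \<le> j" "j \<le> CARD('a)"
  shows "atop p j = a \<longleftrightarrow> ptop p a = j" "abot p j = a \<longleftrightarrow> pbot p a = j"
  using ptop_atop[OF assms] atop_ptop abot_pbot assms(1) by metis+

lemma card_ge_1: "1 \<le> CARD('a::finite)"
  by (simp add: Suc_leI)

lemma irreducible_swap [simp]: "irreducible_perm (prod.swap p) \<longleftrightarrow> irreducible_perm p"
  unfolding irreducible_perm_def fst_swap snd_swap by (simp only: eq_commute[of "pbot p -` _"])

text \<open>Exchanging the two rows interchanges top and bottom operations, so facts about bottom
  operations follow from those about top ones.\<close>

lemma swap_simps [simp]:
  "ptop (prod.swap p) = pbot p" "pbot (prod.swap p) = ptop p"
  "is_perm (prod.swap p) \<longleftrightarrow> is_perm p" "atop (prod.swap p) = abot p" "abot (prod.swap p) = atop p"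
  "valid_perm (prod.swap p) \<longleftrightarrow> valid_perm p"
  "rauzy_op c (prod.swap p) = prod.swap (rauzy_op (\<not> c) p)"
  "winner c (prod.swap p) = winner (\<not> c) p" "loser c (prod.swap p) = loser (\<not> c) p"
  by (auto simp: is_perm_def atop_def abot_def fun_eq_iff valid_perm_def
      rauzy_op_def winner_def loser_def)

lemma Bmat_swap [simp]: "Bmat c (prod.swap p) = Bmat (\<not> c) p"
  by (simp add: Bmat_def)

lemma Omega_swap: "Omega (prod.swap p) = - Omega p"
  by (auto simp: Omega_def vec_eq_iff)

lemma rauzy_arrow_swap: "rauzy_arrow p c q \<Longrightarrow> rauzy_arrow (prod.swap p) (\<not> c) (prod.swap q)"
  by (auto simp: rauzy_arrow_def)

lemma rv_walk_swap: "rv_walk p q M \<Longrightarrow> rv_walk (prod.swap p) (prod.swap q) M"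
proof (induction rule: rv_walk.induct)
  case nil
  show ?case by (rule rv_walk.nil)
next
  case (fwd p1 M c p2)
  then show ?case using rv_walk.fwd[OF _ rauzy_arrow_swap[OF fwd.hyps(2)]] by simp
next
  case (bwd p1 M p2 c)
  then show ?case using rv_walk.bwd[OF _ rauzy_arrow_swap[OF bwd.hyps(2)]] by simp
qed

lemma shift_insert_bij: "k \<le> d \<Longrightarrow> bij_betw (shift_insert d k) {1..d} {1..d}"
  unfolding bij_betw_def
  by (intro conjI endo_inj_surj) (auto simp: shift_insert_def inj_on_def)

lemma is_perm_op_top:
  fixes p :: "('a::finite) iperm"
  assumes "is_perm p"
  shows "is_perm (rauzy_op True p)"
proof -
  have "bij_betw (shift_insert CARD('a) (pbot p (atop p CARD('a))) \<circ> pbot p) UNIV {1..CARD('a)}"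
    using assms is_permD(6)[OF assms] unfolding is_perm_def
    by (intro bij_betw_trans[OF _ shift_insert_bij]) auto
  then show ?thesis using assms by (auto simp: is_perm_def rauzy_op_def)
qed

text \<open>The winner is last on top, so a common prefix after the operation ends before the
  winner's bottom position. Positions up to there are unchanged, and the prefix was already common
  before.\<close>

lemma irreducible_op_top:
  fixes p :: "('a::finite) iperm"
  assumes p: "is_perm p" and irr: "irreducible_perm p"
  shows "irreducible_perm (rauzy_op True p)"
  unfolding irreducible_perm_def
proof (intro allI impI notI, elim conjE)
  fix j assume j: "1 \<le> j" "j < CARD('a)"
    and eq: "ptop (rauzy_op True p) -` {1..j} = pbot (rauzy_op True p) -` {1..j}"
  define w where "w = atop p CARD('a)"
  define k where "k = pbot p w"
  have w: "ptop p w = CARD('a)" unfolding w_def using ptop_atop[OF p] card_ge_1 by blast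
  have bot: "pbot (rauzy_op True p) a = shift_insert CARD('a) k (pbot p a)" for a
    by (simp add: rauzy_op_def w_def k_def)
  have "w \<notin> ptop (rauzy_op True p) -` {1..j}" using w j by (simp add: rauzy_op_def)
  then have "w \<notin> pbot (rauzy_op True p) -` {1..j}" unfolding eq .
  then have "j < k" using is_permD(5)[OF p, of w] by (simp add: bot shift_insert_def k_def)
  then have "pbot (rauzy_op True p) a \<in> {1..j} \<longleftrightarrow> pbot p a \<in> {1..j}" for a
    by (auto simp: bot shift_insert_def)
  then have "ptop p -` {1..j} = pbot p -` {1..j}"
    using eq unfolding vimage_def by (simp add: rauzy_op_def)
  then show False using irr j unfolding irreducible_perm_def by blast
qed

lemma valid_op_top: "valid_perm p \<Longrightarrow> valid_perm (rauzy_op True p)"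
  using is_perm_op_top irreducible_op_top unfolding valid_perm_def by blast

lemma winner_neq_loser:
  fixes p :: "('a::finite) iperm"
  assumes p: "valid_perm p" and d: "2 \<le> CARD('a)"
  shows "atop p CARD('a) \<noteq> abot p CARD('a)"
proof
  assume "atop p CARD('a) = abot p CARD('a)"
  have P: "is_perm p" using p by (simp add: valid_perm_def)
  define w where "w = atop p CARD('a)"
  have w: "ptop p w = CARD('a)" "pbot p w = CARD('a)" unfolding w_def
    using ptop_atop[OF P card_ge_1 order_refl] \<open>atop p _ = _\<close> by auto
  have "ptop p a \<in> {1..CARD('a) - 1} \<longleftrightarrow> a \<noteq> w" "pbot p a \<in> {1..CARD('a) - 1} \<longleftrightarrow> a \<noteq> w" for a
    using is_permD(3-6)[OF P, of a] is_perm_inject[OF P, of a w] w by (auto simp: le_less)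
  then have "ptop p -` {1..CARD('a) - 1} = pbot p -` {1..CARD('a) - 1}" by blast
  moreover have "1 \<le> CARD('a) - 1" "CARD('a) - 1 < CARD('a)" using d by auto
  ultimately show False using p unfolding valid_perm_def irreducible_perm_def by blast
qed

lemma winner_loser: 
  fixes p :: "('a::finite) iperm"
  assumes "valid_perm p" "2 \<le> CARD('a)"
  shows "winner c p \<noteq> loser c p"
  using winner_neq_loser[OF assms] by (auto simp: winner_def loser_def)

section \<open>Rauzy matrices and walks\<close>

lemma Bmat_mult: "(Bmat c p ** A) $ i $ j = A $ i $ j + (if i = loser c p then A $ winner c p $ j else 0)"
  by (simp add: Bmat_def matrix_matrix_mult_def distrib_right sum.distrib if_distrib[of "\<lambda>x. x * _"]
      cong: if_cong)

lemma mult_Bmat_transpose: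
  "(A ** transpose (Bmat c p)) $ i $ j = A $ i $ j + (if j = loser c p then A $ i $ winner c p else 0)"
  by (simp add: Bmat_def transpose_def matrix_matrix_mult_def distrib_left sum.distrib
      if_distrib[of "\<lambda>x. _ * x"] cong: if_cong)

lemma vector_Bmat: "u v* Bmat c p = u + u $ loser c p *s axis (winner c p) 1"
  by (simp add: Bmat_def vector_matrix_mult_def vec_eq_iff distrib_left sum.distrib axis_def
      if_distrib[of "\<lambda>x. _ * x"] cong: if_cong)

lemma matrix_eqI_vector:
  assumes "\<And>u. u v* A = u v* (B :: int^'m^'n)"
  shows "A = B"
proof -
  have row: "axis i 1 v* C = C $ i" for i and C :: "int^'m^'n"
    by (simp add: vector_matrix_mult_def vec_eq_iff axis_def if_distribR if_distrib cong: if_cong)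
  show ?thesis using assms row by (metis vec_eq_iff)
qed

lemma axis_vector_matrix: "axis i 1 v* C = (C :: int^'m^'n) $ i"
  by (simp add: vector_matrix_mult_def vec_eq_iff axis_def if_distribR if_distrib cong: if_cong)

lemma matrix_inv_eq:
  assumes "A ** B = mat 1" "B ** A = mat 1"
  shows "A ** matrix_inv A = mat 1" "matrix_inv A ** A = mat 1"
  using someI[of "\<lambda>B. A ** B = mat 1 \<and> B ** A = mat 1" B] assms by (auto simp: matrix_inv_def)

lemma Bmat_inverse:
  fixes p :: "('a::finite) iperm"
  assumes "winner c p \<noteq> loser c p"
  shows "Bmat c p ** matrix_inv (Bmat c p) = mat 1" "matrix_inv (Bmat c p) ** Bmat c p = mat 1"
proof -
  \<comment> \<open>Subtracting the elementary matrix inverts adding it, because its square vanishes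
    when winner and loser differ.\<close>
  define E :: "int^'a^'a" where "E = (\<chi> i j. (if i = j then 1 else 0) - (if i = loser c p \<and> j = winner c p then 1 else 0))"
  have E: "u v* E = u - u $ loser c p *s axis (winner c p) 1" for u
    by (simp add: E_def vector_matrix_mult_def vec_eq_iff right_diff_distrib sum_subtractf axis_def
      if_distrib[of "\<lambda>x. _ * x"] cong: if_cong)
  have "Bmat c p ** E = mat 1" "E ** Bmat c p = mat 1"
    using assms by (auto intro!: matrix_eqI_vector simp: vector_matrix_mul_assoc[symmetric] E vector_Bmat axis_def)
  then show "Bmat c p ** matrix_inv (Bmat c p) = mat 1" "matrix_inv (Bmat c p) ** Bmat c p = mat 1"
    by (rule matrix_inv_eq)+
qed

lemma rauzy_arrowD: "rauzy_arrow p c q \<Longrightarrow> valid_perm p" "rauzy_arrow p c q \<Longrightarrow> valid_perm q"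
  by (auto simp: rauzy_arrow_def)

lemma rv_walk_trans:
  assumes "rv_walk q r N" "rv_walk p q M"
  shows "rv_walk p r (N ** M)"
  using assms
proof (induction rule: rv_walk.induct)
  case (fwd p1 N c p2)
  then show ?case using rv_walk.fwd by (metis matrix_mul_assoc)
next
  case (bwd p1 N p2 c)
  then show ?case using rv_walk.bwd by (metis matrix_mul_assoc)
qed simp

lemma rv_walk_inverse:
  fixes p :: "('a::finite) iperm"
  assumes "rv_walk p q M" and d: "2 \<le> CARD('a)"
  obtains N where "rv_walk q p N" "N ** M = mat 1" "M ** N = mat 1"
proof -
  have "\<exists>N. rv_walk q p N \<and> N ** M = mat 1 \<and> M ** N = mat 1" using assms(1)
  proof (induction rule: rv_walk.induct)
    case nil
    then show ?case using rv_walk.nil by fastforce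
  next
    case (fwd p1 M c p2)
    then obtain N where N: "rv_walk p1 p N" "N ** M = mat 1" "M ** N = mat 1" by blast
    let ?B = "Bmat c p1"
    note B = Bmat_inverse[OF winner_loser[OF rauzy_arrowD(1)[OF fwd.hyps(2)] d, of c]]
    have "rv_walk p2 p (N ** matrix_inv ?B)"
      using rv_walk_trans[OF N(1) rv_walk.bwd[OF rv_walk.nil fwd.hyps(2)]] by simp
    moreover have "(N ** matrix_inv ?B) ** (?B ** M) = mat 1"
      by (metis B(2) N(2) matrix_mul_assoc matrix_mul_lid)
    moreover have "(?B ** M) ** (N ** matrix_inv ?B) = mat 1"
      by (metis B(1) N(3) matrix_mul_assoc matrix_mul_lid)
    ultimately show ?case by blast
  next
    case (bwd p1 M p2 c)
    then obtain N where N: "rv_walk p1 p N" "N ** M = mat 1" "M ** N = mat 1" by blast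
    let ?B = "Bmat c p2"
    note B = Bmat_inverse[OF winner_loser[OF rauzy_arrowD(1)[OF bwd.hyps(2)] d, of c]]
    have "rv_walk p2 p (N ** ?B)"
      using rv_walk_trans[OF N(1) rv_walk.fwd[OF rv_walk.nil bwd.hyps(2)]] by simp
    moreover have "(N ** ?B) ** (matrix_inv ?B ** M) = mat 1"
      by (metis B(1) N(2) matrix_mul_assoc matrix_mul_lid)
    moreover have "(matrix_inv ?B ** M) ** (N ** ?B) = mat 1"
      by (metis B(2) N(3) matrix_mul_assoc matrix_mul_lid)
    ultimately show ?case by blast
  qed
  then show ?thesis using that by blast
qed

lemma rv_walk_valid: "rv_walk p q M \<Longrightarrow> valid_perm p \<Longrightarrow> valid_perm q"
  by (induction rule: rv_walk.induct) (auto dest: rauzy_arrowD)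

lemma rv_walk_class: "rv_walk p q M \<Longrightarrow> q \<in> rauzy_class p"
proof (induction rule: rv_walk.induct)
  case (fwd p1 M c p2)
  then show ?case unfolding rauzy_class_def by (auto intro: rtrancl_into_rtrancl)
next
  case (bwd p1 M p2 c)
  then show ?case unfolding rauzy_class_def by (auto intro: rtrancl_into_rtrancl)
qed (simp add: rauzy_class_def)

text \<open>Only the row and column of the loser change, each gaining the winner's. This matches the
  loser's new place just after the winner in the bottom row, letter by letter.\<close>

lemma Omega_arrow_top:
  fixes p :: "('a::finite) iperm"
  assumes p: "valid_perm p" and d: "2 \<le> CARD('a)"
  shows "Bmat True p ** Omega p ** transpose (Bmat True p) = Omega (rauzy_op True p)"
proof -
  have P: "is_perm p" using p by (simp add: valid_perm_def)
  define w l where "w = atop p CARD('a)" and "l = abot p CARD('a)"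
  have wl: "w \<noteq> l" using winner_neq_loser[OF p d] by (simp add: w_def l_def)
  have w: "ptop p a \<le> ptop p w" and l: "pbot p a \<le> pbot p l" and pl: "pbot p l = CARD('a)" for a
    unfolding w_def l_def using ptop_atop[OF P card_ge_1 order_refl] is_permD(4,6)[OF P, of a] by simp_all
  note inject = is_perm_inject[OF P]
  have bot: "pbot (rauzy_op True p) a = (if pbot p a \<le> pbot p w then pbot p a else if a = l then pbot p w + 1 else pbot p a + 1)" for a
    using inject(2)[of a l] pl by (auto simp: rauzy_op_def shift_insert_def w_def)
  have top: "ptop (rauzy_op True p) = ptop p" by (simp add: rauzy_op_def)
  have "(Bmat True p ** Omega p ** transpose (Bmat True p)) $ i $ j = Omega (rauzy_op True p) $ i $ j" for i j
  proof -
    have lt: "ptop p a < ptop p w \<longleftrightarrow> a \<noteq> w" "pbot p a < pbot p l \<longleftrightarrow> a \<noteq> l" 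
      "\<not> ptop p w < ptop p a" "\<not> pbot p l < pbot p a" for a
      using w[of a] l[of a] inject by (auto simp: le_less)
    show ?thesis
      unfolding mult_Bmat_transpose Bmat_mult
      using wl lt[of i] lt[of j] lt(1)[of l] lt(2)[of w] inject(1)[of i j] inject(2)[of i j] inject(2)[of i w] inject(2)[of j w]
      unfolding winner_def loser_def if_True w_def[symmetric] l_def[symmetric] Omega_def top bot vec_lambda_beta
      by (cases "i = l"; cases "j = l"; cases "i = w"; cases "j = w") (simp_all, (linarith | auto)+)
  qed
  then show ?thesis by (simp add: vec_eq_iff)
qed

lemma Omega_arrow:
  fixes p :: "('a::finite) iperm"
  assumes a: "rauzy_arrow p c q" and d: "2 \<le> CARD('a)"
  shows "Bmat c p ** Omega p ** transpose (Bmat c p) = Omega q"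
proof (cases c)
  case True
  then show ?thesis using Omega_arrow_top[OF rauzy_arrowD(1)[OF a] d] a by (simp add: rauzy_arrow_def)
next
  case False
  have neg: "A ** (- X) ** B = - (A ** X ** B)" for A B X :: "int^'a^'a"
    by (simp add: matrix_matrix_mult_def vec_eq_iff sum_negf)
  have "valid_perm (prod.swap p)" using rauzy_arrowD(1)[OF a] by simp
  from Omega_arrow_top[OF this d] have "Bmat c p ** Omega p ** transpose (Bmat c p) = Omega (rauzy_op c p)"
    using False by (simp add: Omega_swap neg)
  then show ?thesis using a by (simp add: rauzy_arrow_def)
qed

text \<open>Needed for the quadratic form: the odd pairing keeps its value 1 on the sum of these two
  basis vectors.\<close>

lemma Omega_loser_winner:
  fixes p :: "('a::finite) iperm"
  assumes p: "valid_perm p" and d: "2 \<le> CARD('a)"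
  shows "odd (Omega p $ loser c p $ winner c p)"
proof -
  have P: "is_perm p" using p by (simp add: valid_perm_def)
  define w l where "w = atop p CARD('a)" and "l = abot p CARD('a)"
  have wl: "w \<noteq> l" using winner_neq_loser[OF p d] by (simp add: w_def l_def)
  have "ptop p w = CARD('a)" "pbot p l = CARD('a)"
    unfolding w_def l_def using ptop_atop[OF P card_ge_1 order_refl] by simp_all
  then have "ptop p l < ptop p w" "pbot p w < pbot p l"
    using is_permD(4,6)[OF P, of l] is_permD(4,6)[OF P, of w] is_perm_inject[OF P, of w l] wl by (auto simp: le_less)
  then show ?thesis by (auto simp: Omega_def winner_def loser_def w_def l_def)
qed

section \<open>The invariant forms\<close>

definition form :: "('a::finite) iperm \<Rightarrow> int^'a \<Rightarrow> int^'a \<Rightarrow> int" where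
  "form p u v = scalar_product (u v* Omega p) v"

text \<open>An integral lift of \<open>Qform\<close>, so that the polarisation law can be read off
  an identity of integers.\<close>

definition Qint :: "('a::finite) iperm \<Rightarrow> int^'a \<Rightarrow> int" where
  "Qint p u = (\<Sum>(a, b)\<in>{(a, b). ptop p a < ptop p b}. u $ a * Omega p $ a $ b * u $ b) + (\<Sum>a\<in>UNIV. u $ a)"

lemma form_sum: "form p u v = (\<Sum>(a, b)\<in>UNIV. u $ a * Omega p $ a $ b * v $ b)"
proof -
  have "form p u v = (\<Sum>b\<in>UNIV. \<Sum>a\<in>UNIV. u $ a * Omega p $ a $ b * v $ b)"
    by (simp add: form_def scalar_product_def vector_matrix_mult_def sum_distrib_right)
  also have "\<dots> = (\<Sum>a\<in>UNIV. \<Sum>b\<in>UNIV. u $ a * Omega p $ a $ b * v $ b)" by (rule sum.swap)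
  finally show ?thesis by (simp add: sum.cartesian_product)
qed

lemma scalar_product_simps:
  fixes u v w :: "int^'n::finite"
  shows "scalar_product (u + v) w = scalar_product u w + scalar_product v w"
    "scalar_product (k *s u) w = k * scalar_product u w"
    "scalar_product u (v + w) = scalar_product u v + scalar_product u w"
    "scalar_product u (axis i k) = u $ i * k"
  by (simp_all add: scalar_product_def algebra_simps sum.distrib sum_distrib_left axis_def
      if_distrib[of "\<lambda>x. _ * x"] cong: if_cong)

lemma scale_vector_matrix: "(k *s u) v* A = k *s (u v* (A :: int^'m^'n))"
  by (simp add: vector_matrix_mult_def vec_eq_iff sum_distrib_left mult.assoc)

lemma form_axis: "form p u (axis b 1) = (u v* Omega p) $ b"
  by (simp add: form_def scalar_product_simps)

lemma form_axis_axis: "form p (axis a 1) (axis b 1) = Omega p $ a $ b"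
  by (simp add: form_axis axis_vector_matrix)

lemma form_left: "form p (u + v) w = form p u w + form p v w" "form p (k *s u) w = k * form p u w"
  by (simp_all add: form_def vector_matrix_left_distrib scale_vector_matrix scalar_product_simps)

lemma Omega_skew: "Omega p $ a $ b = - Omega p $ b $ a"
  by (auto simp: Omega_def)

lemma form_skew: "form p u v = - form p v u"
proof -
  have "form p u v = (\<Sum>a\<in>UNIV. \<Sum>b\<in>UNIV. u $ a * Omega p $ a $ b * v $ b)"
    by (simp add: form_sum sum.cartesian_product)
  also have "\<dots> = (\<Sum>b\<in>UNIV. \<Sum>a\<in>UNIV. u $ a * Omega p $ a $ b * v $ b)" by (rule sum.swap)
  also have "\<dots> = - (\<Sum>b\<in>UNIV. \<Sum>a\<in>UNIV. v $ b * Omega p $ b $ a * u $ a)"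
    unfolding sum_negf[symmetric] by (intro sum.cong refl) (subst Omega_skew, simp)
  also have "\<dots> = - form p v u" by (simp add: form_sum sum.cartesian_product)
  finally show ?thesis .
qed

lemma scalar_product_adjoint:
  "scalar_product (u v* transpose A) v = scalar_product u (v v* (A :: int^'n::finite^'m::finite))"
proof -
  have "scalar_product (u v* transpose A) v = (\<Sum>i\<in>UNIV. \<Sum>j\<in>UNIV. u $ j * (v $ i * A $ i $ j))"
    by (simp add: scalar_product_def matrix_vector_mult_def sum_distrib_left ac_simps)
  also have "\<dots> = (\<Sum>j\<in>UNIV. \<Sum>i\<in>UNIV. u $ j * (v $ i * A $ i $ j))" by (rule sum.swap)
  also have "\<dots> = scalar_product u (v v* A)"
    by (simp add: scalar_product_def vector_matrix_mult_def sum_distrib_left)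
  finally show ?thesis .
qed

lemma form_congruence:
  assumes "M ** Omega p ** transpose M = Omega q"
  shows "form p (u v* M) (v v* M) = form q u v"
  by (simp add: form_def assms[symmetric] vector_matrix_mul_assoc[symmetric] scalar_product_adjoint del: vector_transpose_matrix)

text \<open>The form is a double sum; skewness reflects the half below the top order onto the half
  above. The cross terms of \<open>Qint\<close> thus equal the form up to twice an integer.\<close>

lemma Qint_add:
  fixes p :: "('a::finite) iperm"
  assumes p: "is_perm p"
  shows "odd (Qint p (u + v)) \<longleftrightarrow> ((odd (Qint p u) \<longleftrightarrow> odd (Qint p v)) \<longleftrightarrow> odd (form p u v))"
proof -
  define L G where "L = {(a, b). ptop p a < ptop p b}" and "G = {(a, b). ptop p b < ptop p a}"
  let ?s = "\<lambda>u v (a, b). u $ a * Omega p $ a $ b * v $ b"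
  have "ptop p a < ptop p b \<or> ptop p b < ptop p a \<or> a = b" for a b
    using is_perm_inject(1)[OF p, of a b] by linarith
  then have split: "UNIV = (L \<union> G) \<union> {(a, b). a = b}" by (auto simp: L_def G_def)
  have skew: "u $ b * Omega p $ b $ a * v $ a = - (v $ a * Omega p $ a $ b * u $ b)" for a b
    by (subst Omega_skew) simp
  have "form p u v = sum (?s u v) (L \<union> G) + sum (?s u v) {(a, b). a = b}"
    unfolding form_sum by (subst split, subst sum.union_disjoint) (auto simp: L_def G_def)
  also have "sum (?s u v) {(a, b). a = b} = 0" by (intro sum.neutral) (auto simp: Omega_def)
  also have "sum (?s u v) (L \<union> G) = sum (?s u v) L + sum (?s u v) G"
    by (subst sum.union_disjoint) (auto simp: L_def G_def)
  also have "sum (?s u v) G = (\<Sum>(a, b)\<in>L. - (v $ a * Omega p $ a $ b * u $ b))"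
    by (rule sum.reindex_bij_witness[of _ prod.swap prod.swap])
      (auto simp: skew L_def G_def)
  finally have form: "form p u v = sum (?s u v) L - sum (?s v u) L"
    by (simp add: case_prod_beta sum_negf)
  have "sum (?s (u + v) (u + v)) L = sum (?s u u) L + sum (?s v v) L + sum (?s u v) L + sum (?s v u) L"
    by (simp add: sum.distrib[symmetric] case_prod_beta algebra_simps)
  then have "Qint p (u + v) = Qint p u + Qint p v + form p u v + 2 * sum (?s v u) L"
    by (simp add: Qint_def L_def[symmetric] form sum.distrib)
  then show ?thesis by simp
qed

lemma Qint_axis: "Qint p (axis a 1) = 1"
proof -
  have "(\<Sum>(a', b)\<in>{(a, b). ptop p a < ptop p b}. axis a 1 $ a' * Omega p $ a' $ b * axis a 1 $ b) = 0"
    by (intro sum.neutral) (auto simp: axis_def)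
  then show ?thesis by (simp add: Qint_def axis_def)
qed

definition quad :: "('a::finite) iperm \<Rightarrow> int^'a \<Rightarrow> bool" where
  "quad p u \<longleftrightarrow> odd (Qint p u)"

lemma of_int_bit: "(of_int n :: bit) = of_bool (odd n)"
proof (cases "even n")
  case True
  then obtain m where "n = m + m" by (metis evenE mult_2)
  then have "(of_int n :: bit) = of_int m + of_int m" by (simp only: of_int_add)
  then show ?thesis using True by simp
next
  case False
  then obtain m where "n = m + m + 1" by (metis oddE mult_2)
  then have "(of_int n :: bit) = of_int m + of_int m + 1" by (simp only: of_int_add of_int_1)
  then show ?thesis using False by simp
qed

definition redv :: "int^'a \<Rightarrow> bit^'a::finite" where "redv u = (\<chi> i. of_int (u $ i))"

lemma redv_surj: "\<exists>v. redv v = u"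
proof
  show "redv (\<chi> i. if u $ i = 1 then 1 else 0) = u" by (auto simp: redv_def vec_eq_iff)
qed

lemma redv_mult: "redv (u v* S) = redv u v* red2 S"
  by (simp add: redv_def red2_def vector_matrix_mult_def vec_eq_iff of_int_sum of_int_mult
      del: add_bit_eq_xor mult_bit_eq_and)

lemma red2_mult: "red2 (A ** B) = red2 A ** red2 B"
  by (simp add: red2_def matrix_matrix_mult_def vec_eq_iff of_int_sum of_int_mult
      del: add_bit_eq_xor mult_bit_eq_and)

lemma red2_one: "red2 (mat 1) = mat 1"
  by (simp add: red2_def mat_def vec_eq_iff)

lemma Qform_redv: "Qform p (redv u) = of_bool (quad p u)"
proof -
  have "Qform p (redv u) = of_int (Qint p u)"
    by (simp add: Qform_def Qint_def redv_def of_int_sum of_int_mult case_prod_beta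
      del: add_bit_eq_xor mult_bit_eq_and)
  then show ?thesis by (simp add: of_int_bit quad_def)
qed

text \<open>Every vector modulo 2 lifts to an integer vector, so invariance can be tested on the
  integral lattice.\<close>

lemma red2_OQ_iff:
  fixes S :: "int^'a::finite^'a"
  assumes "S ** T = mat 1" "T ** S = mat 1"
  shows "red2 S \<in> OQ p \<longleftrightarrow> (\<forall>u. quad p (u v* S) \<longleftrightarrow> quad p u)"
proof -
  have "invertible (red2 S)" unfolding invertible_def using assms red2_mult red2_one by metis
  then have "red2 S \<in> OQ p \<longleftrightarrow> (\<forall>u. Qform p (u v* red2 S) = Qform p u)" by (simp add: OQ_def)
  also have "\<dots> \<longleftrightarrow> (\<forall>u. Qform p (redv u v* red2 S) = Qform p (redv u))" by (metis redv_surj)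
  finally show ?thesis unfolding redv_mult[symmetric] Qform_redv of_bool_eq_iff .
qed

text \<open>Two quadratic refinements of the same form differ by a linear functional modulo 2.\<close>
lemma quadratic_eqI:
  fixes f g :: "int^'n::finite \<Rightarrow> bool"
  assumes f: "\<And>u v. f (u + v) \<longleftrightarrow> ((f u \<longleftrightarrow> f v) \<longleftrightarrow> b u v)"
    and g: "\<And>u v. g (u + v) \<longleftrightarrow> ((g u \<longleftrightarrow> g v) \<longleftrightarrow> b u v)"
    and axis: "\<And>a. f (axis a 1) \<longleftrightarrow> g (axis a 1)"
  shows "f u \<longleftrightarrow> g u"
proof -
  define D where "D = (\<lambda>u. f u \<longleftrightarrow> g u)"
  have add: "D (u + v) \<longleftrightarrow> (D u \<longleftrightarrow> D v)" for u v unfolding D_def f g by blast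
  have D0: "D 0" using add[of 0 0] by simp
  have scale: "D (k *s axis a 1)" for k a
  proof (induction k rule: int_induct[where k = 0])
    case base
    then show ?case using D0 by simp
  next
    case (step1 i)
    have "(i + 1) *s axis a 1 = i *s axis a 1 + (axis a 1 :: int^'n)" by (simp add: vec_eq_iff algebra_simps)
    then show ?case using step1 add axis unfolding D_def by metis
  next
    case (step2 i)
    have "i *s axis a 1 = (i - 1) *s axis a 1 + (axis a 1 :: int^'n)" by (simp add: vec_eq_iff algebra_simps)
    then show ?case using step2 add axis unfolding D_def by metis
  qed
  have sum: "D (\<Sum>a\<in>A. u $ a *s axis a 1)" for A
    by (induction A rule: infinite_finite_induct) (use D0 add scale in auto)
  have "u = (\<Sum>a\<in>UNIV. u $ a *s axis a 1)"
    by (simp add: vec_eq_iff axis_def if_distrib cong: if_cong)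
  then show ?thesis using sum[of UNIV] by (simp add: D_def)
qed

lemma axis_Bmat: "axis a 1 v* Bmat c p = axis a 1 + (if a = loser c p then axis (winner c p) 1 else 0)"
  by (auto simp: vector_Bmat axis_def vec_eq_iff)

text \<open>Both sides refine the same form by \<open>Omega_arrow\<close>, so only basis vectors
  need comparison. All have value 1; the loser's image is a sum of two basis vectors with odd
  pairing, again of value 1.\<close>

lemma quad_arrow:
  fixes p :: "('a::finite) iperm"
  assumes a: "rauzy_arrow p c q" and d: "2 \<le> CARD('a)"
  shows "quad p (u v* Bmat c p) \<longleftrightarrow> quad q u"
proof (rule quadratic_eqI[where f = "\<lambda>u. quad p (u v* Bmat c p)" and b = "\<lambda>u v. odd (form q u v)"])
  have P: "is_perm p" "is_perm q" using rauzy_arrowD[OF a] by (simp_all add: valid_perm_def)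
  note F = form_congruence[OF Omega_arrow[OF a d]]
  show "quad p ((u + v) v* Bmat c p) = ((quad p (u v* Bmat c p) = quad p (v v* Bmat c p)) = odd (form q u v))" for u v
    unfolding quad_def vector_matrix_left_distrib Qint_add[OF P(1)] F ..
  show "quad q (u + v) = ((quad q u = quad q v) = odd (form q u v))" for u v
    unfolding quad_def Qint_add[OF P(2)] ..
  show "quad p (axis a 1 v* Bmat c p) = quad q (axis a 1)" for a
    using Omega_loser_winner[OF rauzy_arrowD(1)[OF a] d, of c]
    by (cases "a = loser c p") (simp_all add: axis_Bmat quad_def Qint_axis Qint_add[OF P(1)] form_axis_axis)
qed

lemma rv_walk_isometry:
  fixes p :: "('a::finite) iperm"
  assumes "rv_walk p q M" and d: "2 \<le> CARD('a)"
  shows "M ** Omega p ** transpose M = Omega q \<and> (\<forall>u. quad p (u v* M) \<longleftrightarrow> quad q u)"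
  using assms(1)
proof (induction rule: rv_walk.induct)
  case nil
  then show ?case by (simp add: transpose_mat)
next
  case (fwd p1 M c p2)
  let ?B = "Bmat c p1"
  have "?B ** M ** Omega p ** transpose (?B ** M) = ?B ** (M ** Omega p ** transpose M) ** transpose ?B"
    by (simp add: matrix_transpose_mul matrix_mul_assoc)
  then show ?case using fwd Omega_arrow[OF fwd.hyps(2) d] quad_arrow[OF fwd.hyps(2) d]
    by (simp add: vector_matrix_mul_assoc[symmetric])
next
  case (bwd p1 M p2 c)
  let ?B = "Bmat c p2" and ?I = "matrix_inv (Bmat c p2)"
  note B = Bmat_inverse[OF winner_loser[OF rauzy_arrowD(1)[OF bwd.hyps(2)] d, of c]]
  have "?I ** M ** Omega p ** transpose (?I ** M) = ?I ** (M ** Omega p ** transpose M) ** transpose ?I"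
    by (simp add: matrix_transpose_mul matrix_mul_assoc)
  also have "\<dots> = ?I ** (?B ** Omega p2 ** transpose ?B) ** transpose ?I"
    using bwd Omega_arrow[OF bwd.hyps(2) d] by simp
  also have "\<dots> = (?I ** ?B) ** Omega p2 ** transpose (?I ** ?B)"
    by (simp add: matrix_transpose_mul matrix_mul_assoc)
  finally have "?I ** M ** Omega p ** transpose (?I ** M) = Omega p2" by (simp add: B transpose_mat)
  moreover have "quad p (u v* (?I ** M)) \<longleftrightarrow> quad p2 u" for u
    using bwd quad_arrow[OF bwd.hyps(2) d, of "u v* ?I"]
    by (simp add: vector_matrix_mul_assoc[symmetric]) (simp add: vector_matrix_mul_assoc B)
  ultimately show ?case by blast
qed

section \<open>Unimodularity in the minimal stratum\<close>

text \<open>Rows of \<open>Omega p\<close> are differences of a bottom and a top prefix vector, so modulo the row lattice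
  all prefix vectors along a cycle of \<open>sigma p\<close> agree.\<close>

definition prefix :: "('a::finite \<Rightarrow> nat) \<Rightarrow> nat \<Rightarrow> int^'a" where
  "prefix f j = (\<chi> a. if f a \<le> j then 1 else 0)"

lemma Omega_row:
  assumes "is_perm p"
  shows "Omega p $ a = prefix (pbot p) (pbot p a - 1) - prefix (ptop p) (ptop p a - 1)"
    "Omega p $ a = prefix (pbot p) (pbot p a) - prefix (ptop p) (ptop p a)"
proof -
  have "Omega p $ a $ b = (prefix (pbot p) (pbot p a - 1) - prefix (ptop p) (ptop p a - 1)) $ b
      \<and> Omega p $ a $ b = (prefix (pbot p) (pbot p a) - prefix (ptop p) (ptop p a)) $ b" for b
    using is_permD(3,5)[OF assms, of a] is_perm_inject[OF assms, of a b]
    by (auto simp: Omega_def prefix_def)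
  then show "Omega p $ a = prefix (pbot p) (pbot p a - 1) - prefix (ptop p) (ptop p a - 1)"
    "Omega p $ a = prefix (pbot p) (pbot p a) - prefix (ptop p) (ptop p a)"
    unfolding vec_eq_iff by blast+
qed

text \<open>Reduces to real matrices, where one-sided inverses of square matrices are
  two-sided.\<close>

lemma int_right_inverse_left:
  fixes A B :: "int^'n::finite^'n"
  assumes "A ** B = mat 1"
  shows "B ** A = mat 1"
proof -
  define r where "r = (\<lambda>A::int^'n^'n. (\<chi> i j. real_of_int (A $ i $ j)) :: real^'n^'n)"
  have mult: "r (A ** B) = r A ** r B" for A B
    by (simp add: r_def matrix_matrix_mult_def vec_eq_iff)
  have one: "r (mat 1) = mat 1" by (simp add: r_def mat_def vec_eq_iff)
  have "r A ** r B = mat 1" using assms mult one by metis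
  then have "r B ** r A = mat 1" by (simp add: matrix_left_right_inverse)
  then have "r (B ** A) = r (mat 1)" using mult one by metis
  then show ?thesis by (simp add: r_def vec_eq_iff)
qed

text \<open>The empty prefix is 0 and lies in the row lattice. The single cycle of
  \<open>sigma\<close> carries this to all top prefixes, whose consecutive differences are the basis
  vectors, so the rows span the whole lattice.\<close>

lemma minimal_stratum_unimodular:
  fixes p :: "('a::finite) iperm"
  assumes p: "is_perm p" and min: "minimal_stratum p"
  shows "\<exists>N. Omega p ** N = mat 1"
proof -
  define L where "L = range (\<lambda>u. u v* Omega p)"
  have L_row: "Omega p $ a \<in> L" for a
    unfolding L_def using axis_vector_matrix[of a "Omega p"] by (metis rangeI)
  have L_closed: "u + v \<in> L" "u - v \<in> L" if "u \<in> L" "v \<in> L" for u v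
    using that unfolding L_def
    by (auto simp: vector_matrix_left_distrib[symmetric] vector_matrix_mult_diff_distrib[symmetric])
  have L0: "0 \<in> L" unfolding L_def using vector_matrix_mult_0[of "Omega p"] by (metis rangeI)
  let ?t = "prefix (ptop p)" and ?b = "prefix (pbot p)"
  have step: "sigma p j \<le> CARD('a) \<and> ?t (sigma p j) \<in> L" if j: "j \<le> CARD('a)" "?t j \<in> L" for j
  proof -
    \<comment> \<open>The three branches of \<open>sigma\<close> use, in turn, the row of the first
      bottom letter, the row of the last bottom letter, and two rows of letters adjacent in the
      bottom row, whose common bottom prefix cancels.\<close>
    consider "j = 0" | "j \<noteq> 0" "j = mono_inv p CARD('a)" | "j \<noteq> 0" "j \<noteq> mono_inv p CARD('a)" by blast
    then show ?thesis
    proof cases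
      case 1
      let ?\<beta> = "abot p 1"
      have "pbot p ?\<beta> = 1" using ptop_atop(2)[OF p order_refl card_ge_1] .
      then have "Omega p $ ?\<beta> = 0 - ?t (sigma p 0)"
        using Omega_row(1)[OF p, of ?\<beta>] is_permD(5)[OF p]
        by (simp add: sigma_def mono_inv_def) (auto simp: prefix_def vec_eq_iff Suc_le_eq)
      then have "?t (sigma p 0) = 0 - Omega p $ ?\<beta>" by simp
      then have "?t (sigma p 0) \<in> L" using L_closed(2)[OF L0 L_row[of ?\<beta>]] by (simp only:)
      moreover have "sigma p 0 \<le> CARD('a)" using is_permD(4)[OF p, of ?\<beta>] by (simp add: sigma_def mono_inv_def)
      ultimately show ?thesis using 1 by simp
    next
      case 2
      let ?\<alpha> = "abot p CARD('a)"
      have "pbot p ?\<alpha> = CARD('a)" using ptop_atop(2)[OF p card_ge_1 order_refl] .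
      moreover have "ptop p ?\<alpha> = j" using 2 by (simp add: mono_inv_def)
      ultimately have "Omega p $ ?\<alpha> = ?b CARD('a) - ?t j" using Omega_row(2)[OF p, of ?\<alpha>] by simp
      moreover have "?b CARD('a) = ?t CARD('a)" using is_permD(4,6)[OF p] by (simp add: prefix_def vec_eq_iff)
      ultimately have "?t CARD('a) = Omega p $ ?\<alpha> + ?t j" by simp
      then have "?t CARD('a) \<in> L" using L_closed(1)[OF L_row j(2)] by simp
      then show ?thesis using 2 by (simp add: sigma_def)
    next
      case 3
      let ?\<alpha> = "atop p j" and ?\<beta> = "abot p (mono p j + 1)"
      have a: "ptop p ?\<alpha> = j" using ptop_atop(1)[OF p] 3 j by simp
      have "mono p j \<noteq> CARD('a)"
      proof
        assume "mono p j = CARD('a)"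
        then have "?\<alpha> = abot p CARD('a)" using abot_pbot[OF p, of ?\<alpha>] by (simp add: mono_def)
        then show False using 3 a by (simp add: mono_inv_def)
      qed
      then have m: "mono p j + 1 \<le> CARD('a)" using is_permD(6)[OF p, of ?\<alpha>] by (simp add: mono_def)
      have b: "pbot p ?\<beta> = mono p j + 1" using ptop_atop(2)[OF p _ m] by simp
      have s: "sigma p j = ptop p ?\<beta> - 1" using 3 by (simp add: sigma_def mono_inv_def)
      have "?t (sigma p j) = ?t j + Omega p $ ?\<alpha> - Omega p $ ?\<beta>"
        unfolding s using Omega_row(2)[OF p, of ?\<alpha>] Omega_row(1)[OF p, of ?\<beta>] a b by (simp add: mono_def)
      then have "?t (sigma p j) \<in> L" using L_closed L_row j(2) by metis
      moreover have "sigma p j \<le> CARD('a)" unfolding s using is_permD(4)[OF p, of ?\<beta>] by simp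
      ultimately show ?thesis by blast
    qed
  qed
  have "(sigma p ^^ n) 0 \<le> CARD('a) \<and> ?t ((sigma p ^^ n) 0) \<in> L" for n
  proof (induction n)
    case 0
    have "?t 0 = 0" using is_permD(3)[OF p] by (auto simp: prefix_def vec_eq_iff Suc_le_eq)
    then show ?case using L0 by simp
  qed (use step in simp)
  then have t: "?t j \<in> L" if "j \<le> CARD('a)" for j using min that unfolding minimal_stratum_def by metis
  have "axis a 1 \<in> L" for a
  proof -
    have "axis a 1 $ b = (?t (ptop p a) - ?t (ptop p a - 1)) $ b" for b
      using is_permD(3)[OF p, of a] is_perm_inject(1)[OF p, of b a]
      by (cases "b = a") (auto simp: axis_def prefix_def)
    then have "axis a 1 = ?t (ptop p a) - ?t (ptop p a - 1)" unfolding vec_eq_iff by blast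
    then show ?thesis using L_closed(2) t is_permD(4)[OF p, of a] by (metis diff_le_self le_trans)
  qed
  then have "\<exists>u. u v* Omega p = axis a 1" for a unfolding L_def by (metis imageE)
  then obtain N where N: "\<And>a. N a v* Omega p = axis a 1" by metis
  define M :: "int^'a^'a" where "M = (\<chi> a. N a)"
  have "M ** Omega p = mat 1"
  proof -
    have "(M ** Omega p) $ a = N a v* Omega p" for a
      by (simp add: M_def matrix_matrix_mult_def vector_matrix_mult_def)
    then show ?thesis by (auto simp: vec_eq_iff N mat_def axis_def)
  qed
  then show ?thesis using int_right_inverse_left by blast
qed

lemma unimodular_walk:
  fixes p :: "('a::finite) iperm"
  assumes w: "rv_walk p q M" and d: "2 \<le> CARD('a)" and "\<exists>N. Omega p ** N = mat 1"
  shows "\<exists>N. Omega q ** N = mat 1"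
proof -
  obtain N where N: "Omega p ** N = mat 1" using assms by blast
  obtain I where I: "I ** M = mat 1" "M ** I = mat 1" using rv_walk_inverse[OF w d] by blast
  have "transpose M ** transpose I = mat 1" using I(1) by (metis matrix_transpose_mul transpose_mat)
  have "Omega q ** (transpose I ** N ** I) = M ** (Omega p ** ((transpose M ** transpose I) ** N)) ** I"
    using rv_walk_isometry[OF w d] by (simp add: matrix_mul_assoc)
  also have "\<dots> = mat 1" unfolding \<open>transpose M ** transpose I = mat 1\<close> by (simp add: N I)
  finally show ?thesis by blast
qed

lemma quadratic_lattice_form:
  fixes p :: "('a::finite) iperm"
  assumes p: "is_perm p" and "\<exists>N. Omega p ** N = mat 1"
  shows "quadratic_lattice (form p) (quad p)"
proof
  obtain N where N: "Omega p ** N = mat 1" using assms by blast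
  fix v n assume dvd: "\<And>x. n dvd form p v x"
  define w where "w = (\<chi> j. (v v* Omega p) $ j div n)"
  have vw: "v v* Omega p = n *s w" using dvd[of "axis _ 1"] by (simp add: vec_eq_iff w_def form_axis)
  have "v = (v v* Omega p) v* N" by (simp add: vector_matrix_mul_assoc N)
  also have "\<dots> = n *s (w v* N)" unfolding vw scale_vector_matrix ..
  finally have "v = n *s (w v* N)" .
  then show "\<exists>v'. v = n *s v'" by blast
qed (rule form_left form_skew | simp only: quad_def Qint_add[OF p])+

text \<open>Matrices act on row vectors from the right, so composing maps reverses the matrix
  product.\<close>

definition RV_maps :: "('a::finite) iperm \<Rightarrow> (int^'a \<Rightarrow> int^'a) set" where
  "RV_maps p = {\<lambda>u. u v* M | M. M \<in> RV p}"

lemma isometry_group_RV: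
  fixes p :: "('a::finite) iperm"
  assumes p: "is_perm p" and u: "\<exists>N. Omega p ** N = mat 1" and d: "2 \<le> CARD('a)"
  shows "isometry_group (form p) (quad p) (RV_maps p)"
proof -
  interpret quadratic_lattice "form p" "quad p" by (rule quadratic_lattice_form[OF p u])
  have inverse: "\<exists>N. N \<in> RV p \<and> N ** M = mat 1 \<and> M ** N = mat 1" if "M \<in> RV p" for M
    using rv_walk_inverse[OF _ d] that unfolding RV_def by blast
  have inv: "bij (\<lambda>u. u v* M)" "inv (\<lambda>u. u v* M) = (\<lambda>u. u v* N)" if "N ** M = mat 1" "M ** N = mat 1" for M N :: "int^'a^'a"
  proof -
    have "(\<lambda>u. u v* M) \<circ> (\<lambda>u. u v* N) = id" "(\<lambda>u. u v* N) \<circ> (\<lambda>u. u v* M) = id"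
      using that by (auto simp: vector_matrix_mul_assoc)
    then show "bij (\<lambda>u. u v* M)" "inv (\<lambda>u. u v* M) = (\<lambda>u. u v* N)"
      using o_bij inv_unique_comp by blast+
  qed
  show ?thesis
  proof
    fix f g assume f: "f \<in> RV_maps p"
    then obtain M where M: "f = (\<lambda>u. u v* M)" "M \<in> RV p" unfolding RV_maps_def by blast
    then obtain N where N: "N \<in> RV p" "N ** M = mat 1" "M ** N = mat 1" using inverse by blast
    show "isometry f" using rv_walk_isometry[of p p M] M(2) d inv(1)[OF N(2,3)] unfolding isometry_def M(1)
      by (simp add: RV_def vector_matrix_left_distrib scale_vector_matrix form_congruence)
    show "inv f \<in> RV_maps p" using N inv(2)[OF N(2,3)] unfolding M(1) RV_maps_def by blast
    assume "g \<in> RV_maps p"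
    then obtain K where K: "g = (\<lambda>u. u v* K)" "K \<in> RV p" unfolding RV_maps_def by blast
    have "f \<circ> g = (\<lambda>u. u v* (K ** M))" by (auto simp: M K vector_matrix_mul_assoc)
    moreover have "K ** M \<in> RV p" using K M rv_walk_trans unfolding RV_def by blast
    ultimately show "f \<circ> g \<in> RV_maps p" unfolding RV_maps_def by blast
  next
    have "mat 1 \<in> RV p" unfolding RV_def using rv_walk.nil by blast
    moreover have "id = (\<lambda>u::int^'a. u v* mat 1)" by auto
    ultimately show "id \<in> RV_maps p" unfolding RV_maps_def by blast
  qed
qed

section \<open>Rotations of the bottom row\<close>

definition rotate_bottom :: "('a::finite) iperm \<Rightarrow> nat \<Rightarrow> 'a iperm" where
  "rotate_bottom p i = (ptop p, \<lambda>a. let k = pbot p (atop p CARD('a)) in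
     if pbot p a \<le> k then pbot p a else if pbot p a \<le> CARD('a) - i then pbot p a + i
     else pbot p a + i - (CARD('a) - k))"

definition rotation_matrix :: "('a::finite) iperm \<Rightarrow> nat \<Rightarrow> int^'a^'a" where
  "rotation_matrix p i = (\<chi> a b. (if a = b then 1 else 0) +
     (if CARD('a) - i < pbot p a \<and> b = atop p CARD('a) then 1 else 0))"

text \<open>Closed form for \<open>i\<close> successive top operations: the positions behind the
  winner's are shifted cyclically, and the letters from the last \<open>i\<close> bottom positions
  have each lost once to the same winner.\<close>

lemma rotate_bottom_walk:
  fixes p :: "('a::finite) iperm"
  assumes v: "valid_perm p"
  shows "i \<le> CARD('a) - pbot p (atop p CARD('a)) \<Longrightarrow> rv_walk p (rotate_bottom p i) (rotation_matrix p i)"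
proof (induction i)
  case 0
  have p: "is_perm p" using v by (simp add: valid_perm_def)
  have "\<not> CARD('a) < pbot p a" for a using is_permD(6)[OF p, of a] by simp
  then have "rotate_bottom p 0 = p" "rotation_matrix p 0 = mat 1"
    using is_permD(6)[OF p] by (auto simp: Let_def rotate_bottom_def prod_eq_iff fun_eq_iff rotation_matrix_def mat_def vec_eq_iff)
  then show ?case using rv_walk.nil by metis
next
  case (Suc i)
  have p: "is_perm p" using v by (simp add: valid_perm_def)
  let ?d = "CARD('a)"
  define w k where "w = atop p ?d" and "k = pbot p w"
  have i: "k + i < ?d" using Suc.prems by (simp add: w_def k_def)
  define r where "r = rotate_bottom p i"
  have walk: "rv_walk p r (rotation_matrix p i)" using Suc by (simp add: r_def)
  have vr: "valid_perm r" using rv_walk_valid[OF walk v] .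
  then have r: "is_perm r" by (simp add: valid_perm_def)
  have top: "ptop r = ptop p" by (simp add: r_def rotate_bottom_def)
  then have atop: "atop r = atop p" by (simp add: atop_def fun_eq_iff)
  have bot: "pbot r a = (if pbot p a \<le> k then pbot p a else if pbot p a \<le> ?d - i then pbot p a + i
     else pbot p a + i - (?d - k))" for a
    by (simp add: r_def rotate_bottom_def Let_def w_def k_def)
  \<comment> \<open>The next loser: after \<open>i\<close> operations the letter originally at this
    position stands last in the bottom row.\<close>
  define l where "l = abot p (?d - i)"
  have l: "pbot p a = ?d - i \<longleftrightarrow> a = l" for a
    using atop_eq_iff(2)[OF p, of "?d - i" a] i by (auto simp: l_def)
  then have "pbot p l = ?d - i" by blast
  then have "pbot r l = ?d" using bot[of l] i by simp
  then have lr: "abot r ?d = l" using atop_eq_iff(2)[OF r card_ge_1 order_refl] by blast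
  have "rauzy_op True r = rotate_bottom p (Suc i)"
  proof (rule prod_eqI)
    show "ptop (rauzy_op True r) = ptop (rotate_bottom p (Suc i))"
      by (simp add: rauzy_op_def rotate_bottom_def top)
    have "pbot r w = k" by (simp add: bot k_def)
    then have *: "pbot (rauzy_op True r) a = shift_insert ?d k (pbot r a)" for a
      by (simp add: rauzy_op_def atop w_def[symmetric])
    have "pbot (rauzy_op True r) a = pbot (rotate_bottom p (Suc i)) a" for a
    proof -
      consider "pbot p a \<le> k" | "k < pbot p a" "pbot p a < ?d - i" | "pbot p a = ?d - i" | "?d - i < pbot p a"
        by linarith
      then show ?thesis using is_permD(6)[OF p, of a] i unfolding * bot
        by cases (auto simp: rotate_bottom_def w_def[symmetric] k_def[symmetric] shift_insert_def)
    qed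
    then show "pbot (rauzy_op True r) = pbot (rotate_bottom p (Suc i))" by blast
  qed
  moreover have "Bmat True r ** rotation_matrix p i = rotation_matrix p (Suc i)"
  proof -
    have "(?d - Suc i < pbot p a) \<longleftrightarrow> (?d - i < pbot p a) \<or> a = l" for a using l[of a] i by linarith
    moreover have "\<not> ?d - i < pbot p l" "\<not> ?d - i < pbot p w" using l[of l] i by (auto simp: k_def)
    ultimately show ?thesis
      by (auto simp: vec_eq_iff Bmat_mult winner_def loser_def atop lr rotation_matrix_def w_def[symmetric])
  qed
  ultimately show ?case
    using rv_walk.fwd[OF walk, of True "rotate_bottom p (Suc i)"] valid_op_top[OF vr] vr
    by (simp add: rauzy_arrow_def)
qed

section \<open>Standard permutations and their transvections\<close>

definition standard_perm :: "('a::finite) iperm \<Rightarrow> bool" where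
  "standard_perm p \<longleftrightarrow> atop p CARD('a) = abot p 1 \<and> atop p 1 = abot p CARD('a)"

lemma rotate_bottom_simps:
  "ptop (rotate_bottom p i) = ptop p" "atop (rotate_bottom p i) = atop p"
  by (simp_all add: rotate_bottom_def atop_def fun_eq_iff)

lemma pbot_rotate_bottom:
  fixes p :: "('a::finite) iperm"
  assumes "pbot p (atop p CARD('a)) < j" "j \<le> CARD('a)"
  shows "pbot p a = j \<Longrightarrow> pbot (rotate_bottom p (CARD('a) - j)) a = CARD('a)"
    "pbot (rotate_bottom p i) (atop p CARD('a)) = pbot p (atop p CARD('a))"
  using assms by (auto simp: rotate_bottom_def Let_def)

lemma card_vimage_perm:
  fixes p :: "('a::finite) iperm"
  assumes "is_perm p" "A \<subseteq> {1..CARD('a)}"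
  shows "card (ptop p -` A) = card A" "card (pbot p -` A) = card A"
proof -
  have "A \<subseteq> range (ptop p)" "A \<subseteq> range (pbot p)"
    using assms unfolding is_perm_def bij_betw_def by simp_all
  then show "card (ptop p -` A) = card A" "card (pbot p -` A) = card A"
    using is_permD(1,2)[OF assms(1)] by (simp_all add: card_vimage_inj)
qed

text \<open>Descent on the bottom position of the last top letter: if it cannot be improved, irreducibility
  forces this position to be 1, and a rotation then makes the permutation standard.\<close>
lemma standard_of_minimal:
  fixes p :: "('a::finite) iperm"
  assumes v: "valid_perm p" and d: "2 \<le> CARD('a)"
    and min: "\<And>q M. rv_walk p q M \<Longrightarrow> pbot p (atop p CARD('a)) \<le> ptop q (abot q CARD('a))"
  shows "\<exists>q M. rv_walk p q M \<and> standard_perm q"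
proof -
  let ?d = "CARD('a)"
  have p: "is_perm p" and irr: "irreducible_perm p" using v by (simp_all add: valid_perm_def)
  define w k where "w = atop p ?d" and "k = pbot p w"
  have w: "ptop p w = ?d" unfolding w_def using ptop_atop(1)[OF p card_ge_1 order_refl] .
  have k: "1 \<le> k" "k \<le> ?d" using is_permD(5,6)[OF p] by (simp_all add: k_def)
  have rotated: "rv_walk p (rotate_bottom p (?d - j)) (rotation_matrix p (?d - j))"
      "abot (rotate_bottom p (?d - j)) ?d = abot p j" if j: "k < j" "j \<le> ?d" for j
  proof -
    show walk: "rv_walk p (rotate_bottom p (?d - j)) (rotation_matrix p (?d - j))"
      using rotate_bottom_walk[OF v, of "?d - j"] j by (simp add: w_def[symmetric] k_def[symmetric])
    have "is_perm (rotate_bottom p (?d - j))" using rv_walk_valid[OF walk v] by (simp add: valid_perm_def)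
    moreover have "pbot p (abot p j) = j" using ptop_atop(2)[OF p] j k by simp
    ultimately show "abot (rotate_bottom p (?d - j)) ?d = abot p j"
      using pbot_rotate_bottom(1)[of p j "abot p j"] j card_ge_1
      by (simp add: atop_eq_iff(2) w_def k_def)
  qed
  have "k = 1"
  proof (rule ccontr)
    assume "k \<noteq> 1"
    have "pbot p -` {k..?d} \<subseteq> ptop p -` {k..?d}"
    proof
      fix a assume "a \<in> pbot p -` {k..?d}"
      then consider "pbot p a = k" | "k < pbot p a" by fastforce
      then have "k \<le> ptop p a"
      proof cases
        case 1
        then have "a = w" using is_perm_inject(2)[OF p] by (simp add: k_def)
        then show ?thesis using w k by simp
      next
        case 2
        note r = rotated[OF 2 is_permD(6)[OF p]]
        show ?thesis using min[OF r(1)] unfolding r(2) rotate_bottom_simps(1)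
          by (simp add: abot_pbot[OF p] w_def k_def)
      qed
      then show "a \<in> ptop p -` {k..?d}" using is_permD(4)[OF p] by simp
    qed
    moreover have "card (pbot p -` {k..?d}) = card {k..?d}" "card (ptop p -` {k..?d}) = card {k..?d}"
      using k by (intro card_vimage_perm[OF p]; simp)+
    ultimately have "pbot p -` {k..?d} = ptop p -` {k..?d}" by (intro card_subset_eq) auto
    moreover have "ptop p a \<in> {1..k - 1} \<longleftrightarrow> ptop p a \<notin> {k..?d}" "pbot p a \<in> {1..k - 1} \<longleftrightarrow> pbot p a \<notin> {k..?d}" for a
      using is_permD(3-6)[OF p, of a] k by auto
    ultimately have "ptop p -` {1..k - 1} = pbot p -` {1..k - 1}" unfolding vimage_def set_eq_iff by simp
    moreover have "1 \<le> k - 1" "k - 1 < ?d" using k \<open>k \<noteq> 1\<close> by auto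
    ultimately show False using irr unfolding irreducible_perm_def by blast
  qed
  define a j where "a = atop p 1" and "j = pbot p a"
  have a: "ptop p a = 1" unfolding a_def using ptop_atop(1)[OF p order_refl card_ge_1] .
  then have "a \<noteq> w" using w d by auto
  then have j: "k < j" "j \<le> ?d"
    using is_permD(5,6)[OF p, of a] is_perm_inject(2)[OF p, of a w] \<open>k = 1\<close> by (auto simp: j_def k_def)
  let ?r = "rotate_bottom p (?d - j)"
  note r = rotated[OF j]
  have pr: "is_perm ?r" using rv_walk_valid[OF r(1) v] by (simp add: valid_perm_def)
  have "abot ?r 1 = w"
    using pbot_rotate_bottom(2)[of p j "?d - j"] j \<open>k = 1\<close> card_ge_1 w_def k_def
    by (simp add: atop_eq_iff(2)[OF pr])
  moreover have "abot ?r ?d = a" using r(2) abot_pbot[OF p, of a] by (simp add: j_def)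
  ultimately have "standard_perm ?r"
    unfolding standard_perm_def rotate_bottom_simps w_def a_def by simp
  then show ?thesis using r(1) by blast
qed

lemma standard_swap: "standard_perm (prod.swap p) \<longleftrightarrow> standard_perm p"
  by (auto simp: standard_perm_def)

text \<open>A reachable permutation with smallest \<open>key\<close> satisfies the minimality needed
  by \<open>standard_of_minimal\<close>, possibly after exchanging the rows.\<close>

lemma reaches_standard:
  fixes p :: "('a::finite) iperm"
  assumes v: "valid_perm p" and d: "2 \<le> CARD('a)"
  shows "\<exists>q M. rv_walk p q M \<and> standard_perm q"
proof -
  let ?d = "CARD('a)"
  define key where "key = (\<lambda>q::'a iperm. min (pbot q (atop q ?d)) (ptop q (abot q ?d)))"
  have "\<exists>M. rv_walk p p M" using rv_walk.nil by blast
  then obtain q where q: "\<exists>M. rv_walk p q M" and least: "\<And>r. \<exists>M. rv_walk p r M \<Longrightarrow> key q \<le> key r"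
    using ex_has_least_nat[of "\<lambda>q. \<exists>M. rv_walk p q M" p key] by blast
  obtain M where M: "rv_walk p q M" using q by blast
  have vq: "valid_perm q" using rv_walk_valid[OF M v] .
  have least': "key q \<le> key r" if "rv_walk q r N" for r N using least rv_walk_trans[OF that M] by blast
  have "\<exists>r N. rv_walk q r N \<and> standard_perm r"
  proof (cases "pbot q (atop q ?d) \<le> ptop q (abot q ?d)")
    case True
    then have "pbot q (atop q ?d) \<le> ptop r (abot r ?d)" if "rv_walk q r N" for r N
      using least'[OF that] by (simp add: key_def)
    then show ?thesis using standard_of_minimal[OF vq d] by blast
  next
    case False
    have "ptop q (abot q ?d) \<le> pbot r (atop r ?d)" if "rv_walk q r N" for r N
      using least'[OF that] False by (simp add: key_def)
    then have "pbot (prod.swap q) (atop (prod.swap q) ?d) \<le> ptop r (abot r ?d)" if "rv_walk (prod.swap q) r N" for r N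
      using rv_walk_swap[OF that] by fastforce
    then obtain r N where r: "rv_walk (prod.swap q) r N" "standard_perm r"
      using standard_of_minimal[of "prod.swap q"] vq d by auto
    then have "rv_walk q (prod.swap r) N" using rv_walk_swap[OF r(1)] by simp
    then show ?thesis using r(2) standard_swap[of r] by blast
  qed
  then show ?thesis using rv_walk_trans[OF _ M] by blast
qed

lemma vector_rotation_matrix:
  fixes p :: "('a::finite) iperm"
  shows "u v* rotation_matrix p i =
    u + (\<Sum>a\<in>UNIV. if CARD('a) - i < pbot p a then u $ a else 0) *s axis (atop p CARD('a)) 1"
  by (simp add: vec_eq_iff rotation_matrix_def vector_matrix_mult_def distrib_left sum.distrib axis_def
      if_distrib[of "\<lambda>x. _ * x"] cong: if_cong)

definition acts_as_transvection :: "('a::finite) iperm \<Rightarrow> int^'a^'a \<Rightarrow> int^'a \<Rightarrow> bool" where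
  "acts_as_transvection p M v \<longleftrightarrow> (\<forall>u. u v* M = u + form p u v *s v)"

text \<open>A full turn restores the permutation, and each letter behind the winner in the bottom
  row has lost once. These are exactly the letters whose basis vectors pair to 1 with that of the
  winner; all others pair to 0.\<close>

lemma top_loop:
  fixes p :: "('a::finite) iperm"
  assumes v: "valid_perm p"
  shows "\<exists>M. rv_walk p p M \<and> acts_as_transvection p M (axis (atop p CARD('a)) 1)"
proof -
  let ?d = "CARD('a)"
  have p: "is_perm p" using v by (simp add: valid_perm_def)
  define w k where "w = atop p ?d" and "k = pbot p w"
  have k: "k \<le> ?d" using is_permD(6)[OF p] by (simp add: k_def)
  have w: "ptop p w = ?d" unfolding w_def using ptop_atop(1)[OF p card_ge_1 order_refl] .
  have "pbot (rotate_bottom p (?d - k)) a = pbot p a" for a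
    using k is_permD(6)[OF p, of a] by (simp add: rotate_bottom_def Let_def w_def[symmetric] k_def[symmetric])
  then have "rotate_bottom p (?d - k) = p"
    by (simp add: prod_eq_iff rotate_bottom_simps fun_eq_iff)
  then have "rv_walk p p (rotation_matrix p (?d - k))"
    using rotate_bottom_walk[OF v, of "?d - k"] by (simp add: w_def k_def)
  moreover have "form p u (axis w 1) = (\<Sum>a\<in>UNIV. if ?d - (?d - k) < pbot p a then u $ a else 0)" for u
  proof -
    have "Omega p $ a $ w = (if k < pbot p a then 1 else 0)" for a
      using is_permD(4)[OF p, of a] is_perm_inject(1)[OF p, of a w] w by (auto simp: Omega_def k_def le_less)
    then have "u $ a * Omega p $ a $ w = (if k < pbot p a then u $ a else 0)" for a by simp
    then show ?thesis using k by (simp add: form_axis vector_matrix_mult_def)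
  qed
  ultimately show ?thesis
    by (auto simp: acts_as_transvection_def vector_rotation_matrix w_def[symmetric])
qed

lemma form_swap: "form (prod.swap p) u v = - form p u v"
  by (simp add: form_sum Omega_swap case_prod_beta sum_negf)

lemma form_self: "form p u u = 0"
  using form_skew[of p u u] by simp

text \<open>Exchanging the rows negates the form, so the loop obtained from \<open>top_loop\<close>
  is the inverse transvection; the reversed walk corrects this.\<close>

lemma bottom_loop:
  fixes p :: "('a::finite) iperm"
  assumes v: "valid_perm p" and d: "2 \<le> CARD('a)"
  shows "\<exists>M. rv_walk p p M \<and> acts_as_transvection p M (axis (abot p CARD('a)) 1)"
proof -
  define e :: "int^'a" where "e = axis (abot p CARD('a)) 1"
  obtain M where M: "rv_walk (prod.swap p) (prod.swap p) M" "acts_as_transvection (prod.swap p) M e"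
    using top_loop[of "prod.swap p"] v by (auto simp: e_def)
  then have "rv_walk p p M" using rv_walk_swap[OF M(1)] by simp
  then obtain N where N: "rv_walk p p N" "N ** M = mat 1" "M ** N = mat 1" using rv_walk_inverse[OF _ d] by blast
  have "u v* N = u + form p u e *s e" for u
  proof -
    have "(u + form p u e *s e) v* M = u"
      using M(2) by (simp add: acts_as_transvection_def form_swap form_left form_self vec_eq_iff)
    then have "(u + form p u e *s e) v* (M ** N) = u v* N" by (metis vector_matrix_mul_assoc)
    then show ?thesis by (simp add: N)
  qed
  then show ?thesis using N(1) unfolding acts_as_transvection_def e_def by blast
qed

lemma transvection_conjugate:
  assumes M: "M ** Omega p ** transpose M = Omega q" and I: "I ** M = mat 1"
    and T: "acts_as_transvection q T v"
  shows "acts_as_transvection p (I ** (T ** M)) (v v* M)"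
  unfolding acts_as_transvection_def
proof
  fix u
  have "u v* (I ** (T ** M)) = ((u v* I) v* T) v* M" by (simp add: vector_matrix_mul_assoc matrix_mul_assoc)
  also have "\<dots> = (u v* I) v* M + form q (u v* I) v *s (v v* M)"
    using T by (simp add: acts_as_transvection_def vector_matrix_left_distrib scale_vector_matrix)
  also have "(u v* I) v* M = u" by (simp add: vector_matrix_mul_assoc I)
  also have "form q (u v* I) v = form p u (v v* M)"
    using form_congruence[OF M, of "u v* I" v] by (simp add: vector_matrix_mul_assoc I)
  finally show "u v* (I ** (T ** M)) = u + form p u (v v* M) *s (v v* M)" .
qed

text \<open>Rotating the bottom row brings each letter to its end before that letter has lost once,
  so that its basis vector is still unchanged.\<close>
lemma standard_transvections:
  fixes p :: "('a::finite) iperm"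
  assumes v: "valid_perm p" and d: "2 \<le> CARD('a)" and s: "standard_perm p"
  shows "\<exists>M. rv_walk p p M \<and> acts_as_transvection p M (axis a 1)"
proof (cases "a = atop p CARD('a)")
  case True
  then show ?thesis using top_loop[OF v] by simp
next
  case False
  let ?d = "CARD('a)"
  have p: "is_perm p" using v by (simp add: valid_perm_def)
  have k: "pbot p (atop p ?d) = 1"
    using s ptop_atop(2)[OF p order_refl card_ge_1] by (simp add: standard_perm_def)
  define j where "j = pbot p a"
  have j: "1 < j" "j \<le> ?d"
    using is_permD(5,6)[OF p, of a] is_perm_inject(2)[OF p, of a "atop p ?d"] False k by (auto simp: j_def)
  let ?r = "rotate_bottom p (?d - j)" and ?M = "rotation_matrix p (?d - j)"
  have walk: "rv_walk p ?r ?M" using rotate_bottom_walk[OF v, of "?d - j"] j k by simp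
  have vr: "valid_perm ?r" using rv_walk_valid[OF walk v] .
  have "pbot p (atop p ?d) < j" using j k by simp
  then have "pbot ?r a = ?d" by (rule pbot_rotate_bottom(1)[OF _ j(2)]) (simp add: j_def)
  then have "abot ?r ?d = a" using vr by (simp add: atop_eq_iff(2) card_ge_1 valid_perm_def)
  then obtain T where T: "rv_walk ?r ?r T" "acts_as_transvection ?r T (axis a 1)"
    using bottom_loop[OF vr d] by auto
  obtain I where I: "rv_walk ?r p I" "I ** ?M = mat 1" using rv_walk_inverse[OF walk d] by blast
  have "rv_walk p p (I ** (T ** ?M))" using rv_walk_trans[OF I(1) rv_walk_trans[OF T(1) walk]] .
  moreover have "axis a 1 v* ?M = axis a 1"
  proof -
    have "(\<Sum>b\<in>UNIV. if ?d - (?d - j) < pbot p b then axis a 1 $ b else 0) = (0::int)"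
      using j by (intro sum.neutral) (auto simp: axis_def j_def)
    then show ?thesis by (simp add: vector_rotation_matrix)
  qed
  ultimately show ?thesis
    using transvection_conjugate[OF conjunct1[OF rv_walk_isometry[OF walk d]] I(2) T(2)] by auto
qed

text \<open>If every two letters are inverted, the bottom order is the reverse of the top order, and
  counting the letters up to \<open>a\<close> gives the formula for its position.\<close>

lemma symmetric_permI:
  fixes p :: "('a::finite) iperm"
  assumes p: "is_perm p" and all: "\<And>a b. a \<noteq> b \<Longrightarrow> Omega p $ a $ b \<noteq> 0"
  shows "symmetric_perm p"
  unfolding symmetric_perm_def
proof
  fix a
  have "pbot p b \<le> pbot p a \<longleftrightarrow> ptop p a \<le> ptop p b" for b
    using all[of a b] is_perm_inject[OF p, of a b] by (cases "a = b") (auto simp: Omega_def split: if_splits)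
  then have "pbot p -` {1..pbot p a} = ptop p -` {ptop p a..CARD('a)}"
    using is_permD(4,5)[OF p] by auto
  moreover have "card (pbot p -` {1..pbot p a}) = card {1..pbot p a}"
    using is_permD(6)[OF p, of a] by (intro card_vimage_perm[OF p]) simp
  moreover have "card (ptop p -` {ptop p a..CARD('a)}) = card {ptop p a..CARD('a)}"
    using is_permD(3)[OF p, of a] by (intro card_vimage_perm[OF p]) simp
  ultimately show "pbot p a = CARD('a) + 1 - ptop p a" by simp
qed

lemma standard_Omega:
  fixes p :: "('a::finite) iperm"
  assumes p: "is_perm p" and s: "standard_perm p" and d: "2 \<le> CARD('a)"
  defines "x \<equiv> atop p 1" and "y \<equiv> atop p CARD('a)"
  shows "a \<noteq> x \<Longrightarrow> Omega p $ x $ a = 1" "a \<noteq> y \<Longrightarrow> Omega p $ a $ y = 1" "x \<noteq> y"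
proof -
  have x: "ptop p x = 1" "pbot p x = CARD('a)" and y: "ptop p y = CARD('a)" "pbot p y = 1"
    using s ptop_atop[OF p order_refl card_ge_1] ptop_atop[OF p card_ge_1 order_refl]
    by (simp_all add: standard_perm_def x_def y_def)
  show "x \<noteq> y" using x y d by auto
  show "a \<noteq> x \<Longrightarrow> Omega p $ x $ a = 1" "a \<noteq> y \<Longrightarrow> Omega p $ a $ y = 1"
    using x y is_permD(3-6)[OF p, of a] is_perm_inject[OF p, of a x] is_perm_inject[OF p, of a y]
    by (auto simp: Omega_def)
qed

lemma int_span_add: "t \<in> int_span B \<Longrightarrow> s \<in> int_span B \<Longrightarrow> s + t \<in> int_span B"
proof (induction t rule: int_span.induct)
  case (add t b)
  then show ?case using int_span.add[of "s + t" B b] by (simp add: add.assoc)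
next
  case (diff t b)
  then show ?case using int_span.diff[of "s + t" B b] by (simp add: add_diff_eq)
qed simp

lemma int_span_scale: "b \<in> B \<Longrightarrow> k *s b \<in> int_span B"
proof (induction k rule: int_induct[where k = 0])
  case base
  then show ?case by (simp add: int_span.zero)
next
  case (step1 i)
  then show ?case using int_span.add[of "i *s b" B b] by (simp add: vector_sadd_rdistrib)
next
  case (step2 i)
  then show ?case using int_span.diff[of "i *s b" B b] by (simp add: vector_ssub_ldistrib vector_sub_rdistrib)
qed

lemma int_span_sum: "(\<And>i. i \<in> I \<Longrightarrow> f i \<in> int_span B) \<Longrightarrow> sum f I \<in> int_span B"
  by (induction I rule: infinite_finite_induct) (auto intro: int_span.zero int_span_add)

text \<open>A failure of symmetry gives two letters with pairing 0. Since the first and last top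
  letters pair to 1 or -1 with every other letter, neither of the two is among them, and both yield
  vectors of the spanning set of \<open>W\<close>.\<close>

lemma standard_full_monodromy:
  fixes p :: "('a::finite) iperm"
  assumes v: "valid_perm p" and d: "2 \<le> CARD('a)" and s: "standard_perm p"
    and u: "\<exists>N. Omega p ** N = mat 1" and "\<not> symmetric_perm p"
  shows "\<exists>x y B c d. full_monodromy (form p) (quad p) (RV_maps p) x y B c d"
proof -
  have p: "is_perm p" using v by (simp add: valid_perm_def)
  interpret G: isometry_group "form p" "quad p" "RV_maps p" by (rule isometry_group_RV[OF p u d])
  obtain c d where cd: "c \<noteq> d" "Omega p $ c $ d = 0" using symmetric_permI[OF p] assms(5) by blast
  define xa ya where "xa = atop p 1" and "ya = atop p CARD('a)"
  note O = standard_Omega[OF p s \<open>2 \<le> CARD('a)\<close>, folded xa_def ya_def]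
  have nxy: "c \<noteq> xa" "d \<noteq> xa" "c \<noteq> ya" "d \<noteq> ya"
    using cd O(1,2) Omega_skew[of p c d] by (metis neg_0_equal_iff_equal zero_neq_one)+
  define e :: "'a \<Rightarrow> int^'a" where "e = (\<lambda>a. axis a 1)"
  have form_e: "form p (e a) (e b) = Omega p $ a $ b" for a b unfolding e_def by (rule form_axis_axis)
  have quad_e: "quad p (e a)" for a by (simp add: quad_def Qint_axis e_def)
  have e_\<Delta>: "e a \<in> G.\<Delta>" for a
  proof -
    obtain M where M: "rv_walk p p M" "acts_as_transvection p M (e a)"
      using standard_transvections[OF v \<open>2 \<le> CARD('a)\<close> s] unfolding e_def by blast
    then have "G.transv (e a) = (\<lambda>u. u v* M)" by (auto simp: G.transv_def acts_as_transvection_def)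
    then have "G.transv (e a) \<in> RV_maps p" using M(1) unfolding RV_maps_def RV_def by blast
    then show ?thesis by (simp add: G.\<Delta>_def)
  qed
  \<comment> \<open>The correction makes \<open>b a\<close> orthogonal to the plane, and adding
    \<open>e xa + e ya\<close> back gives a basis vector already known to lie in
    \<open>\<Delta>\<close>.\<close>
  define b where "b = (\<lambda>a. e a - e xa - e ya)"
  define B where "B = b ` (- {xa, ya})"
  have Oxy: "Omega p $ xa $ ya = 1" "Omega p $ ya $ xa = -1" using O(1)[of ya] O(3) Omega_skew[of p ya xa] by auto
  have O': "Omega p $ a $ xa = -1" "Omega p $ a $ ya = 1" if "a \<notin> {xa, ya}" for a
    using that O(1,2)[of a] Omega_skew[of p a xa] by auto
  have O0: "Omega p $ a $ a = 0" for a by (simp add: Omega_def)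
  have diff: "form p (u - v) w = form p u w - form p v w" "form p w (u - v) = form p w u - form p w v" for u v w
    by (rule G.diff_left G.diff_right)+
  have b_W: "form p (b a) (e xa) = 0" "form p (b a) (e ya) = 0" if "a \<notin> {xa, ya}" for a
    using O'[OF that] by (simp_all add: b_def diff form_e Oxy O0)
  have coord: "e a $ i = (if i = a then 1 else 0)" for a i by (simp add: e_def axis_def)
  have "plane_monodromy (form p) (quad p) (RV_maps p) (e xa) (e ya)"
    by unfold_locales (simp_all add: form_e Oxy quad_e e_\<Delta>)
  then interpret P: plane_monodromy "form p" "quad p" "RV_maps p" "e xa" "e ya" .
  have "full_monodromy (form p) (quad p) (RV_maps p) (e xa) (e ya) B (b c) (b d)"
  proof
    show BW: "B \<subseteq> P.W" using b_W by (auto simp: B_def G.perp_def)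
    show "\<not> quad p v" if "v \<in> B" for v
      using that O' by (auto simp: B_def b_def G.q_diff quad_e form_e Oxy diff)
    show "e xa + e ya + v \<in> G.\<Delta>" if "v \<in> B" for v
    proof -
      obtain a where "v = b a" using \<open>v \<in> B\<close> by (auto simp: B_def)
      then have "e xa + e ya + v = e a" by (simp add: b_def)
      then show ?thesis using e_\<Delta> by simp
    qed
    show "P.W \<subseteq> int_span B"
    proof
      fix w assume w: "w \<in> P.W"
      \<comment> \<open>This combination agrees with \<open>w\<close> in every coordinate outside
        \<open>xa\<close> and \<open>ya\<close>, so the difference lies both in the plane and in its
        complement and must vanish.\<close>
      define w' where "w' = (\<Sum>a\<in>- {xa, ya}. w $ a *s b a)"
      have span: "w' \<in> int_span B" unfolding w'_def by (intro int_span_sum int_span_scale) (simp add: B_def)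
      have "w' \<in> P.W"
      proof -
        have "(\<Sum>a\<in>A. w $ a *s b a) \<in> P.W" if "A \<subseteq> - {xa, ya}" for A
          using that by (induction A rule: infinite_finite_induct)
            (use BW in \<open>auto simp: B_def intro!: G.perp_closed\<close>)
        then show ?thesis unfolding w'_def by blast
      qed
      then have ww: "w - w' \<in> P.W" using w by (rule G.perp_closed(3)[rotated])
      define i j where "i = (w - w') $ xa" and "j = (w - w') $ ya"
      have off: "(w - w') $ a = 0" if a: "a \<notin> {xa, ya}" for a
      proof -
        have "w' $ a = (\<Sum>a'\<in>- {xa, ya}. if a' = a then w $ a else 0)"
          unfolding w'_def sum_component using a by (intro sum.cong) (auto simp: b_def coord)
        then show ?thesis using a by simp
      qed
      have "(w - w') $ a = (i *s e xa + j *s e ya) $ a" for a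
        using off[of a] O(3) by (cases "a = xa"; cases "a = ya") (auto simp: coord i_def j_def)
      then have decomp: "w - w' = i *s e xa + j *s e ya" unfolding vec_eq_iff by blast
      have "form p (w - w') (e ya) = 0" "form p (w - w') (e xa) = 0" using P.W_D[OF ww] by auto
      then have "i = 0" "j = 0" unfolding decomp by (simp_all add: form_left form_e O0 Oxy)
      then have "w = w'" using decomp by simp
      then show "w \<in> int_span B" using span by simp
    qed
    show "b c \<in> B" "b d \<in> B" using nxy by (auto simp: B_def)
    have "Omega p $ xa $ c = 1" "Omega p $ xa $ d = 1" "Omega p $ c $ ya = 1"  "Omega p $ ya $ d = -1"
      "Omega p $ c $ xa = -1"
      using O(1,2) nxy Omega_skew[of p ya d] Omega_skew[of p c xa] by auto
    then show "even (form p (b c) (b d))" by (simp add: b_def diff form_e Oxy O0 cd)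
    show "b c \<noteq> 2 *s v" for v
    proof
      assume "b c = 2 *s v"
      then have "even (b c $ c)" by simp
      then show False using nxy by (simp add: b_def coord)
    qed
    show "b d \<noteq> 2 *s v" for v
    proof
      assume "b d = 2 *s v"
      then have "even (b d $ d)" by simp
      then show False using nxy by (simp add: b_def coord)
    qed
    show "b c - b d \<noteq> 2 *s v" for v
    proof
      assume "b c - b d = 2 *s v"
      then have "even ((b c - b d) $ c)" by simp
      then show False using nxy cd by (simp add: b_def coord)
    qed
  qed
  then show ?thesis by blast
qed

section \<open>From isometries to Rauzy--Veech matrices\<close>

lemma Sp_inverse:
  assumes N: "Omega p ** N = mat 1" and S: "S \<in> Sp p"
  obtains T where "S ** T = mat 1" "T ** S = mat 1"
proof -
  have "S ** (Omega p ** transpose S ** N) = mat 1"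
    using S N by (simp add: Sp_def matrix_mul_assoc)
  then show ?thesis using that int_right_inverse_left by blast
qed

lemma RV_subset:
  fixes p :: "('a::finite) iperm"
  assumes d: "2 \<le> CARD('a)" and M: "M \<in> RV p"
  shows "M \<in> Sp p" "red2 M \<in> OQ p"
proof -
  have w: "rv_walk p p M" using M by (simp add: RV_def)
  obtain N where N: "N ** M = mat 1" "M ** N = mat 1" using rv_walk_inverse[OF w d] by blast
  note i = rv_walk_isometry[OF w d]
  show "M \<in> Sp p" using i by (simp add: Sp_def)
  show "red2 M \<in> OQ p" using i red2_OQ_iff[OF N(2,1)] by simp
qed

lemma standard_RV:
  fixes p :: "('a::finite) iperm"
  assumes v: "valid_perm p" and d: "2 \<le> CARD('a)" and s: "standard_perm p"
    and N: "Omega p ** N = mat 1" and ns: "\<not> symmetric_perm p"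
    and S: "S \<in> Sp p" "red2 S \<in> OQ p"
  shows "S \<in> RV p"
proof -
  obtain x y B c d where "full_monodromy (form p) (quad p) (RV_maps p) x y B c d"
    using standard_full_monodromy[OF v d s _ ns] N by blast
  then interpret full_monodromy "form p" "quad p" "RV_maps p" x y B c d .
  obtain T where T: "S ** T = mat 1" "T ** S = mat 1" using Sp_inverse[OF N S(1)] .
  have "(\<lambda>u. u v* S) \<circ> (\<lambda>u. u v* T) = id" "(\<lambda>u. u v* T) \<circ> (\<lambda>u. u v* S) = id"
    using T by (auto simp: vector_matrix_mul_assoc)
  then have "bij (\<lambda>u. u v* S)" using o_bij by blast
  moreover have "quad p (u v* S) \<longleftrightarrow> quad p u" for u using S(2) red2_OQ_iff[OF T] by blast
  moreover have "form p (u v* S) (u' v* S) = form p u u'" for u u'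
    using S(1) by (intro form_congruence) (simp add: Sp_def)
  ultimately have "isometry (\<lambda>u. u v* S)"
    by (simp add: isometry_def vector_matrix_left_distrib scale_vector_matrix)
  then have "(\<lambda>u. u v* S) \<in> RV_maps p" by (rule isometry_mem)
  then obtain M where "M \<in> RV p" "(\<lambda>u. u v* S) = (\<lambda>u. u v* M)" unfolding RV_maps_def by blast
  then show ?thesis using matrix_eqI_vector[of S M] by metis
qed

theorem theorem1p3:
  fixes p :: "('a::finite) iperm" and g :: nat
  assumes "g \<ge> 3"
    and "CARD('a) = 2 * g"
    and "is_perm p" and "irreducible_perm p" and "nondegenerate_perm p"
    and "minimal_stratum p"
    and "\<not> hyperelliptic_class p"
  shows "RV p = {S \<in> Sp p. red2 S \<in> OQ p}"
proof
  have d: "2 \<le> CARD('a)" using assms(1,2) by simp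
  have v: "valid_perm p" using assms(3,4) by (simp add: valid_perm_def)
  show "RV p \<subseteq> {S \<in> Sp p. red2 S \<in> OQ p}" using RV_subset[OF d] by blast
  obtain q M where M: "rv_walk p q M" and q: "standard_perm q" using reaches_standard[OF v d] by blast
  have vq: "valid_perm q" using rv_walk_valid[OF M v] .
  have ns: "\<not> symmetric_perm q" using rv_walk_class[OF M] assms(7) by (auto simp: hyperelliptic_class_def)
  obtain N where N: "Omega p ** N = mat 1" using minimal_stratum_unimodular[OF assms(3,6)] by blast
  obtain N' where N': "Omega q ** N' = mat 1" using unimodular_walk[OF M d] N by blast
  obtain I where I: "rv_walk q p I" "I ** M = mat 1" "M ** I = mat 1" using rv_walk_inverse[OF M d] by blast
  note iM = rv_walk_isometry[OF M d] and iI = rv_walk_isometry[OF I(1) d]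
  show "{S \<in> Sp p. red2 S \<in> OQ p} \<subseteq> RV p"
  proof
    fix S assume "S \<in> {S \<in> Sp p. red2 S \<in> OQ p}"
    then have S: "S ** Omega p ** transpose S = Omega p" "red2 S \<in> OQ p" and Sp: "S \<in> Sp p" by (auto simp: Sp_def)
    obtain T where T: "S ** T = mat 1" "T ** S = mat 1" using Sp_inverse[OF N Sp] .
    \<comment> \<open>Conjugation by the walk matrix turns \<open>S\<close> into an automorphism of
      the forms of the standard permutation \<open>q\<close>; the resulting closed walk at
      \<open>q\<close> is then carried back to \<open>p\<close>.\<close>
    let ?S = "M ** S ** I" and ?T = "M ** T ** I"
    have "?S ** Omega q ** transpose ?S = M ** (S ** (I ** Omega q ** transpose I) ** transpose S) ** transpose M"
      by (simp add: matrix_transpose_mul matrix_mul_assoc)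
    also have "\<dots> = Omega q" using iI iM S(1) by simp
    finally have "?S \<in> Sp q" by (simp add: Sp_def)
    moreover have "?S ** ?T = M ** (S ** ((I ** M) ** T)) ** I" "?T ** ?S = M ** (T ** ((I ** M) ** S)) ** I"
      by (simp_all add: matrix_mul_assoc)
    then have T': "?S ** ?T = mat 1" "?T ** ?S = mat 1" by (simp_all add: I T)
    have "quad q (u v* ?S) \<longleftrightarrow> quad q u" for u
      using iM iI S(2)[unfolded red2_OQ_iff[OF T]] by (simp add: vector_matrix_mul_assoc[symmetric])
    then have "red2 ?S \<in> OQ q" using red2_OQ_iff[OF T'] by blast
    ultimately have "rv_walk q q ?S" using standard_RV[OF vq d q N' ns] by (simp add: RV_def)
    then have "rv_walk p p (I ** (?S ** M))" using rv_walk_trans[OF I(1) rv_walk_trans[OF _ M]] by blast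
    moreover have "I ** (?S ** M) = (I ** M) ** S ** (I ** M)" by (simp add: matrix_mul_assoc)
    ultimately show "S \<in> RV p" by (simp add: I RV_def)
  qed
qed

end
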